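(* For $|q|<1$ the following four identities hold, where all sums run over integers $n,m\ge 0$: \begin{align*} &\sum_{n,m \geq 0} (-1)^mq^{3\binom{n+1}{2}-3m(m+1)}\frac{(-q,-q^5;q^6)_m}{(q^6;q^6)_m(q^3;q^3)_{n-2m}}=\frac{(q^4,q^8;q^{12})_{\infty}}{(q^6;q^{12})_{\infty}},\\ &\sum_{n,m \geq 0} (-1)^{m+1} q^{3\binom{n-1}{2}+2n -3m(m+1)-1} \frac{(-q,-q^5;q^6)_m}{(q^6;q^6)_m(q^3;q^3)_{n-2m}} (1-q^{3n+1}+q^{3n-6m})=\frac{(q;q^6)_{\infty}(q^{10};q^{12})_{\infty}}{(q^5;q^{6})_{\infty}},\\ &\sum_{n,m \geq 0} (-1)^{m+1} q^{3\binom{n+1}{2} -3m(m+1)-1} \frac{(-q,-q^5;q^6)_m}{(q^6;q^6)_m(q^3;q^3)_{n-2m}} (1-q^{3n+1}+q^{3n-6m})=\frac{(q^2,q^{10};q^{12})_{\infty}}{(q^6;q^{12})_{\infty}},\\ &\sum_{n,m \geq 0} (-1)^{m+1} q^{3\binom{n+1}{2}-2n-3m(m+1)-1} \frac{(-q,-q^5;q^6)_m}{(q^6;q^6)_m(q^3;q^3)_{n-2m}}\Bigl(1 + q^{3n-12m-3} (1 + q^{1 + 6 m}) \bigl(q^{3 n} - q^{6 m} (1 + q^3)\bigr)\Bigr)=\frac{(q^2,q^5,q^{11};q^{12})_{\infty}}{(q;q^6)_{\infty}}. \end{align*}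
   Context: $q$-Pochhammer notation: $(a;q)_n=\prod_{j=0}^{n-1}(1-aq^j)$ for $n\ge 1$, $(a;q)_0=1$, $(a;q)_\infty=\prod_{j\ge 0}(1-aq^j)$, $(a_1,\dots,a_k;q)_n=(a_1;q)_n\cdots(a_k;q)_n$. By convention $1/(q^3;q^3)_k=0$ for every integer $k\le -1$, so only terms with $n\ge 2m$ contribute. For any integer $x$, $\binom{x}{2}=x(x-1)/2$.
   Formalization: The second and third identities, false as printed, are proved with factor (1-q^{3n+1}-q^{3n-6m}) instead of (1-q^{3n+1}+q^{3n-6m}), and the second with 3binom(n,2) instead of 3binom(n-1,2); the last three identities are stated for q≠0, since q^{-1} occurs. *)

theory Defs
  imports "HOL-Analysis.Analysis"
begin

definition qpoch :: "complex \<Rightarrow> complex \<Rightarrow> nat \<Rightarrow> complex"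
  where "qpoch a q n = (\<Prod>j<n. 1 - a * q ^ j)"

definition qpoch_inf :: "complex \<Rightarrow> complex \<Rightarrow> complex"
  where "qpoch_inf a q = (\<Prod>j. 1 - a * q ^ j)"

text \<open>The reciprocal \<open>1 / (q; q)\<^sub>k\<close> for an integer \<open>k\<close>; it is zero by convention when \<open>k < 0\<close>.\<close>

definition inv_qpoch_int :: "complex \<Rightarrow> int \<Rightarrow> complex"
  where "inv_qpoch_int q k = (if k < 0 then 0 else 1 / qpoch q q (nat k))"

text \<open>The binomial coefficient \<open>x (x - 1) / 2\<close> at an arbitrary integer; the division is exact.\<close>

definition binom2 :: "int \<Rightarrow> int"
  where "binom2 x = x * (x - 1) div 2"

text \<open>
  The factor \<open>(-q, -q^5; q^6)\<^sub>m / ((q^6; q^6)\<^sub>m (q^3; q^3)\<^sub>n\<^sub>-\<^sub>2\<^sub>m)\<close> shared by the four double sums.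
  The index \<open>n - 2m\<close> is an integer difference, not the truncated one on \<open>nat\<close>.

  In the source, the second and third identities are printed with the factor
  \<open>1 - q^(3n+1) + q^(3n-6m)\<close>, and the second with \<open>3 binom(n-1, 2)\<close> in the exponent. As printed
  both fail: their left-hand sides, as Laurent series in \<open>q\<close>, begin with \<open>2 q^(-3)\<close>
  and \<open>-2 q^(-1)\<close>, while the right-hand sides are power series. They are stated here with
  \<open>1 - q^(3n+1) - q^(3n-6m)\<close> and, in the second, \<open>3 binom(n, 2)\<close>.
\<close>

definition double_coeff :: "complex \<Rightarrow> nat \<Rightarrow> nat \<Rightarrow> complex"
  where "double_coeff q n m =
    qpoch (- q) (q ^ 6) m * qpoch (- (q ^ 5)) (q ^ 6) m / qpoch (q ^ 6) (q ^ 6) m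
      * inv_qpoch_int (q ^ 3) (int n - 2 * int m)"

end

theory Submission
  imports Defs
begin

text \<open>
  Put \<open>Q = q^6\<close> and \<open>n = 2m + k\<close>. The inner sum over \<open>k\<close> is a combination of Euler series
  \<open>\<Sum>\<^sub>k p^(k choose 2) z^k / (p; p)\<^sub>k = (-z; p)\<^sub>\<infinity>\<close> with \<open>p = q^3\<close>, and the extra factors in the last three
  identities are such that the combination collapses to a single product. Since \<open>p^2 = Q\<close>, that
  product splits into two products to the base \<open>Q\<close>. The remaining sum over \<open>m\<close> is Andrews' \<open>q\<close>-analogue
  of Bailey's theorem in the first and third identities, with \<open>b = -q^3\<close> and \<open>b = -q^9\<close>. In the second
  and fourth, one of the two products combines with a finite factor of the summand, and what is left
  is a \<open>\<^sub>1\<phi>\<^sub>1\<close> sum.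

  Each of these classical sums satisfies a first-order functional equation in its argument, verified
  termwise by telescoping; iterating it towards \<open>0\<close>, where the sum is \<open>1\<close>, gives the product.
\<close>

section \<open>Finite and infinite q-Pochhammer symbols\<close>

lemma qpoch_0 [simp]: "qpoch a q 0 = 1"
  by (simp add: qpoch_def)

lemma qpoch_Suc: "qpoch a q (Suc n) = qpoch a q n * (1 - a * q ^ n)"
  by (simp add: qpoch_def)

lemma qpoch_add: "qpoch a q (m + n) = qpoch a q m * qpoch (a * q ^ m) q n"
  by (induction n) (simp_all add: qpoch_Suc power_add mult_ac)

text \<open>Separates the factors with even exponent of \<open>q\<close> from those with odd
  exponent.\<close>

lemma qpoch_dissect: "qpoch a q (2 * n) = qpoch a (q ^ 2) n * qpoch (a * q) (q ^ 2) n"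
proof (induction n)
  case (Suc n)
  have "qpoch a q (2 * Suc n) = qpoch a q (2 * n) * (1 - a * q ^ (2 * n)) * (1 - a * q * q ^ (2 * n))"
    by (simp add: qpoch_Suc mult_ac)
  then show ?case
    unfolding Suc.IH by (simp add: qpoch_Suc mult_ac flip: power_mult)
qed simp

lemma qpoch_square: "qpoch (a ^ 2) (q ^ 2) n = qpoch a q n * qpoch (- a) q n"
proof (induction n)
  case (Suc n)
  have "1 - a ^ 2 * (q ^ 2) ^ n = (1 - a * q ^ n) * (1 - (- a) * q ^ n)"
    by (simp add: algebra_simps power2_eq_square power_mult_distrib)
  then show ?case
    by (simp add: Suc.IH qpoch_Suc mult_ac)
qed simp

section \<open>Nonvanishing and bounds for finite symbols\<close>

lemma norm_mult_power_less_one: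
  fixes a q :: complex
  assumes "norm a < 1" "norm q < 1"
  shows "norm (a * q ^ n) < 1"
proof -
  have "norm (a * q ^ n) \<le> norm a"
    using assms by (simp add: norm_mult norm_power mult_left_le power_le_one)
  then show ?thesis using assms by simp
qed

lemma qpoch_nonzero:
  assumes "norm a < 1" "norm q < 1"
  shows "qpoch a q n \<noteq> 0"
  using norm_mult_power_less_one[OF assms]
  by (auto simp: qpoch_def) (metis norm_one less_irrefl)

text \<open>A crude geometric bound suffices: in every series below the factor
  \<open>Q ^ (n choose 2)\<close> beats any geometric growth.\<close>

lemma norm_qpoch_le:
  assumes "norm q < 1"
  shows "norm (qpoch a q n) \<le> (1 + norm a) ^ n"
proof (induction n)
  case (Suc n)
  have "norm (1 - a * q ^ n) \<le> 1 + norm a * norm q ^ n"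
    using norm_triangle_ineq4[of 1 "a * q ^ n"] by (simp add: norm_mult norm_power)
  also have "\<dots> \<le> 1 + norm a"
    using assms by (simp add: mult_left_le power_le_one)
  finally have "norm (1 - a * q ^ n) \<le> 1 + norm a" .
  then have "norm (qpoch a q n) * norm (1 - a * q ^ n) \<le> (1 + norm a) ^ n * (1 + norm a)"
    using Suc by (intro mult_mono) auto
  then show ?case
    by (simp add: qpoch_Suc norm_mult mult.commute)
qed simp

text \<open>Every factor of the denominator has norm at least \<open>1 - norm q\<close>.\<close>

lemma norm_inverse_qpoch_le:
  assumes "norm q < 1"
  shows "norm (1 / qpoch q q n) \<le> (1 / (1 - norm q)) ^ n"
proof (induction n)
  case (Suc n)
  have "norm (q * q ^ n) \<le> norm q"
    using assms by (simp add: norm_mult norm_power mult_left_le power_le_one)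
  then have "1 - norm q \<le> norm (1 - q * q ^ n)"
    using norm_triangle_ineq2[of 1 "q * q ^ n"] by simp
  then have "norm (1 / (1 - q * q ^ n)) \<le> 1 / (1 - norm q)"
    using assms by (simp add: norm_divide frac_le)
  then have "norm (1 / qpoch q q n) * norm (1 / (1 - q * q ^ n))
      \<le> (1 / (1 - norm q)) ^ n * (1 / (1 - norm q))"
    using Suc assms by (intro mult_mono) auto
  then show ?case
    by (simp add: qpoch_Suc norm_mult norm_divide mult_ac)
qed simp

section \<open>Infinite products as limits of finite ones\<close>

lemma summable_norm_geometric_mult:
  assumes "norm (q :: complex) < 1"
  shows "summable (\<lambda>j. norm (a * q ^ j))"
  using assms by (simp add: norm_mult norm_power summable_mult summable_geometric)

lemma convergent_prod_qpoch:
  assumes "norm (q :: complex) < 1"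
  shows "convergent_prod (\<lambda>j. 1 - a * q ^ j)"
  by (intro abs_convergent_prod_imp_convergent_prod summable_imp_abs_convergent_prod)
    (use assms summable_norm_geometric_mult[of q a] in simp)

lemma qpoch_tendsto:
  assumes "norm q < 1"
  shows "qpoch a q \<longlonglongrightarrow> qpoch_inf a q"
  using has_prod_imp_tendsto'[OF convergent_prod_has_prod[OF convergent_prod_qpoch[OF assms, of a]]]
  by (simp add: qpoch_def[abs_def] qpoch_inf_def)

lemma qpoch_inf_0 [simp]: "qpoch_inf 0 q = 1"
  by (simp add: qpoch_inf_def)

lemma qpoch_inf_nonzero:
  assumes "norm a < 1" "norm q < 1"
  shows "qpoch_inf a q \<noteq> 0"
  unfolding qpoch_inf_def
proof (rule prodinf_nonzero[OF convergent_prod_qpoch[OF assms(2)]])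
  show "1 - a * q ^ i \<noteq> 0" for i
    using norm_mult_power_less_one[OF assms, of i] by (metis eq_iff_diff_eq_0 norm_one less_irrefl)
qed

lemma qpoch_inf_split:
  assumes "norm q < 1"
  shows "qpoch_inf a q = qpoch a q n * qpoch_inf (a * q ^ n) q"
proof -
  have "(\<lambda>k. qpoch a q (n + k)) \<longlonglongrightarrow> qpoch_inf a q"
    using LIMSEQ_ignore_initial_segment[OF qpoch_tendsto[OF assms], of a n] by (simp add: add.commute)
  moreover have "(\<lambda>k. qpoch a q (n + k)) \<longlonglongrightarrow> qpoch a q n * qpoch_inf (a * q ^ n) q"
    unfolding qpoch_add by (intro tendsto_intros qpoch_tendsto assms)
  ultimately show ?thesis by (rule LIMSEQ_unique)
qed

lemma qpoch_inf_step:
  assumes "norm q < 1"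
  shows "qpoch_inf a q = (1 - a) * qpoch_inf (a * q) q"
  using qpoch_inf_split[OF assms, of a 1] by (simp add: qpoch_Suc)

lemma qpoch_inf_dissect:
  assumes "norm q < 1"
  shows "qpoch_inf a q = qpoch_inf a (q ^ 2) * qpoch_inf (a * q) (q ^ 2)"
proof -
  have q2: "norm (q ^ 2) < 1"
    using assms by (simp add: norm_power power_less_one_iff)
  have "(\<lambda>k. qpoch a q (2 * k)) \<longlonglongrightarrow> qpoch_inf a q"
    using LIMSEQ_subseq_LIMSEQ[OF qpoch_tendsto[OF assms, of a], of "\<lambda>k. 2 * k"]
    by (simp add: o_def strict_mono_def)
  moreover have "(\<lambda>k. qpoch a q (2 * k)) \<longlonglongrightarrow> qpoch_inf a (q ^ 2) * qpoch_inf (a * q) (q ^ 2)"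
    unfolding qpoch_dissect by (intro tendsto_intros qpoch_tendsto q2)
  ultimately show ?thesis by (rule LIMSEQ_unique)
qed

lemma qpoch_inf_square:
  assumes "norm q < 1"
  shows "qpoch_inf (a ^ 2) (q ^ 2) = qpoch_inf a q * qpoch_inf (- a) q"
proof -
  have q2: "norm (q ^ 2) < 1"
    using assms by (simp add: norm_power power_less_one_iff)
  have "qpoch (a ^ 2) (q ^ 2) \<longlonglongrightarrow> qpoch_inf a q * qpoch_inf (- a) q"
    unfolding qpoch_square[abs_def] by (intro tendsto_intros qpoch_tendsto assms)
  then show ?thesis
    using qpoch_tendsto[OF q2] LIMSEQ_unique by blast
qed

text \<open>The distance of a product from 1 is at most that of the product of the
  \<open>1 + norm (a * q ^ j)\<close>, and \<open>1 + t\<close> is at most \<open>exp t\<close>; the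
  exponents sum to a geometric series. The bound gives both continuity at \<open>a = 0\<close> and a
  growth estimate in \<open>a\<close>.\<close>

lemma norm_qpoch_inf_minus_one_le:
  assumes "norm q < 1"
  shows "norm (qpoch_inf a q - 1) \<le> exp (norm a / (1 - norm q)) - 1"
proof (rule LIMSEQ_le_const2)
  show "(\<lambda>n. norm (qpoch a q n - 1)) \<longlonglongrightarrow> norm (qpoch_inf a q - 1)"
    by (intro tendsto_intros qpoch_tendsto assms)
  show "\<exists>N. \<forall>n\<ge>N. norm (qpoch a q n - 1) \<le> exp (norm a / (1 - norm q)) - 1"
  proof (intro exI allI impI)
    fix n
    have "norm (qpoch a q n - 1) \<le> (\<Prod>j<n. 1 + norm (a * q ^ j)) - 1"
      using norm_prod_minus1_le_prod_minus1[of "\<lambda>j. - (a * q ^ j)" "{..<n}"]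
      by (simp add: qpoch_def)
    also have "(\<Prod>j<n. 1 + norm (a * q ^ j)) \<le> (\<Prod>j<n. exp (norm (a * q ^ j)))"
      by (intro prod_mono conjI exp_ge_add_one_self) auto
    also have "\<dots> = exp (\<Sum>j<n. norm (a * q ^ j))"
      by (simp add: exp_sum)
    also have "(\<Sum>j<n. norm (a * q ^ j)) \<le> (\<Sum>j. norm (a * q ^ j))"
      using summable_norm_geometric_mult[OF assms] by (intro sum_le_suminf) auto
    also have "(\<Sum>j. norm (a * q ^ j)) = norm a / (1 - norm q)"
      using assms by (simp add: norm_mult norm_power suminf_mult suminf_geometric summable_geometric)
    finally show "norm (qpoch a q n - 1) \<le> exp (norm a / (1 - norm q)) - 1"
      by simp
  qed
qed

lemma norm_qpoch_inf_le:
  assumes "norm q < 1"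
  shows "norm (qpoch_inf a q) \<le> exp (norm a / (1 - norm q))"
  using norm_qpoch_inf_minus_one_le[OF assms, of a] norm_triangle_sub[of "qpoch_inf a q" 1] by simp

lemma qpoch_inf_tendsto_one:
  assumes "norm q < 1" "(X \<longlongrightarrow> 0) F"
  shows "((\<lambda>n. qpoch_inf (X n) q) \<longlongrightarrow> 1) F"
proof (rule Lim_null[THEN iffD2], rule Lim_null_comparison)
  show "\<forall>\<^sub>F n in F. norm (qpoch_inf (X n) q - 1) \<le> exp (norm (X n) / (1 - norm q)) - 1"
    using norm_qpoch_inf_minus_one_le[OF assms(1)] by simp
  have "((\<lambda>n. exp (norm (X n) / (1 - norm q)) - 1) \<longlongrightarrow> exp (norm (0::complex) / (1 - norm q)) - 1) F"
    using assms by (intro tendsto_intros) auto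
  then show "((\<lambda>n. exp (norm (X n) / (1 - norm q)) - 1) \<longlongrightarrow> 0) F" by simp
qed

section \<open>Functional equations for q-series\<close>

text \<open>The ratio of consecutive terms is \<open>r ^ n * K\<close>, which tends to 0 whatever
  the size of \<open>K\<close>.\<close>

lemma summable_power_choose_two:
  fixes r K :: real
  assumes "0 \<le> r" "r < 1" "0 \<le> K"
  shows "summable (\<lambda>n. r ^ (n choose 2) * K ^ n)"
proof -
  have "(\<lambda>n. r ^ n * K) \<longlonglongrightarrow> 0 * K"
    using assms by (intro tendsto_intros LIMSEQ_power_zero) auto
  then have "\<forall>\<^sub>F n in sequentially. r ^ n * K < 1 / 2"
    by (rule order_tendstoD) simp
  then obtain N where N: "\<And>n. n \<ge> N \<Longrightarrow> r ^ n * K < 1 / 2"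
    by (auto simp: eventually_sequentially)
  show ?thesis
  proof (rule summable_ratio_test)
    fix n assume "n \<ge> N"
    have "r ^ (Suc n choose 2) * K ^ Suc n = (r ^ n * K) * (r ^ (n choose 2) * K ^ n)"
      by (simp add: numeral_2_eq_2 power_add)
    also have "\<dots> \<le> 1 / 2 * (r ^ (n choose 2) * K ^ n)"
      using N[OF \<open>n \<ge> N\<close>] assms by (intro mult_right_mono) auto
    finally show "norm (r ^ (Suc n choose 2) * K ^ Suc n) \<le> 1 / 2 * norm (r ^ (n choose 2) * K ^ n)"
      using assms by simp
  qed simp
qed

text \<open>The factor \<open>1 / (c x; Q)\<^sub>n\<close> of a basic hypergeometric term is cleared by multiplying the whole
  series by \<open>(c x; Q)\<^sub>\<infinity>\<close>; this leaves the infinite product at the shifted point.\<close>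

definition qseries :: "(nat \<Rightarrow> complex) \<Rightarrow> complex \<Rightarrow> complex \<Rightarrow> complex \<Rightarrow> nat \<Rightarrow> complex"
  where "qseries T c Q x n = T n * x ^ n * qpoch_inf (c * x * Q ^ n) Q"

text \<open>The bound is uniform for \<open>norm x\<close> up to \<open>R\<close>; hence it serves
  for summability at one point and also as the dominating series when \<open>x\<close> tends to
  0.\<close>

lemma norm_qseries_le:
  assumes Q: "norm Q < 1" and T: "\<And>n. norm (T n) \<le> norm Q ^ (n choose 2) * K ^ n"
    and x: "norm x \<le> R"
  shows "norm (qseries T c Q x n)
    \<le> norm Q ^ (n choose 2) * (K * R) ^ n * exp (norm c * R / (1 - norm Q))"
proof -
  have R: "0 \<le> R" using x norm_ge_zero order_trans by blast
  have "norm (c * x * Q ^ n) \<le> norm c * R * 1"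
    unfolding norm_mult norm_power
    using Q x R by (intro mult_mono power_le_one) auto
  then have "norm (c * x * Q ^ n) / (1 - norm Q) \<le> norm c * R / (1 - norm Q)"
    using Q by (intro divide_right_mono) auto
  then have "norm (qpoch_inf (c * x * Q ^ n) Q) \<le> exp (norm c * R / (1 - norm Q))"
    using norm_qpoch_inf_le[OF Q] order_trans exp_le_cancel_iff by meson
  moreover have "norm (x ^ n) \<le> R ^ n"
    using x by (simp add: norm_power power_mono)
  moreover have "0 \<le> norm Q ^ (n choose 2) * K ^ n"
    using T[of n] norm_ge_zero order_trans by blast
  ultimately have "norm (T n) * norm (x ^ n) * norm (qpoch_inf (c * x * Q ^ n) Q)
      \<le> norm Q ^ (n choose 2) * K ^ n * R ^ n * exp (norm c * R / (1 - norm Q))"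
    using T[of n] R by (intro mult_mono) auto
  then show ?thesis
    by (simp add: qseries_def norm_mult power_mult_distrib mult_ac)
qed

text \<open>The instance \<open>n = 1\<close> decides, since \<open>1 choose 2 = 0\<close> leaves
  only \<open>K\<close> on the right.\<close>

lemma power_bound_nonneg:
  assumes "\<And>n. norm (T n :: complex) \<le> norm (Q :: complex) ^ (n choose 2) * K ^ n"
  shows "0 \<le> K"
proof -
  have "norm (T 1) \<le> K"
    using assms[of 1] by (simp add: numeral_2_eq_2)
  then show ?thesis using norm_ge_zero order_trans by blast
qed

lemma summable_norm_qseries:
  assumes Q: "norm Q < 1" and T: "\<And>n. norm (T n) \<le> norm Q ^ (n choose 2) * K ^ n"
  shows "summable (\<lambda>n. norm (qseries T c Q x n))"
proof (rule summable_comparison_test')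
  show "summable (\<lambda>n. norm Q ^ (n choose 2) * (K * norm x) ^ n * exp (norm c * norm x / (1 - norm Q)))"
    using Q power_bound_nonneg[OF T] by (intro summable_mult2 summable_power_choose_two) auto
  show "norm (norm (qseries T c Q x n))
      \<le> norm Q ^ (n choose 2) * (K * norm x) ^ n * exp (norm c * norm x / (1 - norm Q))" for n
    using norm_qseries_le[OF assms, of x "norm x"] by simp
qed

text \<open>Tannery's theorem allows the limit inside the sum. Terms with \<open>n > 0\<close>
  vanish there, and the term \<open>n = 0\<close> tends to \<open>T 0\<close> because its infinite
  product tends to 1.\<close>

lemma suminf_qseries_tendsto_one:
  assumes Q: "norm Q < 1" and T: "\<And>n. norm (T n) \<le> norm Q ^ (n choose 2) * K ^ n"
    and T0: "T 0 = 1" and X: "X \<longlonglongrightarrow> 0"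
  shows "(\<lambda>N. \<Sum>n. qseries T c Q (X N) n) \<longlonglongrightarrow> 1"
proof -
  have "\<forall>\<^sub>F N in sequentially. norm (X N) < 1"
    using tendsto_norm_zero[OF X] by (rule order_tendstoD) simp
  then have "\<forall>\<^sub>F z in sequentially \<times>\<^sub>F sequentially. norm (X (snd z)) < 1"
    using eventually_prodI[OF eventually_True[of sequentially]] by simp
  then have bound: "\<forall>\<^sub>F (n, N) in sequentially \<times>\<^sub>F sequentially. norm (qseries T c Q (X N) n)
      \<le> norm Q ^ (n choose 2) * (K * 1) ^ n * exp (norm c * 1 / (1 - norm Q))"
  proof eventually_elim
    case (elim z)
    then show ?case
      using norm_qseries_le[OF Q T, of "X (snd z)" 1 c "fst z"] by (simp add: case_prod_beta)
  qed
  have lim: "(\<lambda>N. qseries T c Q (X N) n) \<longlonglongrightarrow> (if n = 0 then 1 else 0)" for n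
  proof -
    have "(\<lambda>N. c * X N * Q ^ n) \<longlonglongrightarrow> c * 0 * Q ^ n"
      by (intro tendsto_intros X)
    then have "(\<lambda>N. qpoch_inf (c * X N * Q ^ n) Q) \<longlonglongrightarrow> 1"
      by (intro qpoch_inf_tendsto_one Q) simp
    then have "(\<lambda>N. qseries T c Q (X N) n) \<longlonglongrightarrow> T n * 0 ^ n * 1"
      unfolding qseries_def by (intro tendsto_intros X)
    then show ?thesis
      using T0 by (cases "n = 0") (simp_all add: power_0_left)
  qed
  have "summable (\<lambda>n. norm Q ^ (n choose 2) * (K * 1) ^ n * exp (norm c * 1 / (1 - norm Q)))"
    using Q power_bound_nonneg[OF T] by (intro summable_mult2 summable_power_choose_two) auto
  from tannerys_theorem[OF lim bound this]
  have "(\<lambda>N. \<Sum>n. qseries T c Q (X N) n) \<longlonglongrightarrow> (\<Sum>n. if n = 0 then 1 else 0)"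
    by simp
  then show ?thesis
    using suminf_finite[of "{0}" "\<lambda>n. if n = (0::nat) then 1 else (0::complex)"] by simp
qed

text \<open>Iterating \<open>F x = (1 - u * x) * (1 - v * x) * F (x * r)\<close> peels off one
  factor of each product per step, while the argument of \<open>F\<close> tends to 0. The equation
  is assumed as a series of termwise differences, the form that telescoping delivers. Taking
  \<open>v = 0\<close> covers the case of a single product.\<close>

lemma qseries_sums_of_functional_equation:
  assumes Q: "norm Q < 1" and T: "\<And>n. norm (T n) \<le> norm Q ^ (n choose 2) * K ^ n"
    and T0: "T 0 = 1" and r: "norm r < 1"
    and eq: "\<And>x. (\<lambda>n. qseries T c Q x n - (1 - u * x) * (1 - v * x) * qseries T c Q (x * r) n) sums 0"
  shows "qseries T c Q x sums (qpoch_inf (u * x) r * qpoch_inf (v * x) r)"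
proof -
  define F where "F y = (\<Sum>n. qseries T c Q y n)" for y
  have sums: "qseries T c Q y sums F y" for y
    unfolding F_def by (intro summable_sums summable_norm_cancel[OF summable_norm_qseries[OF Q T]])
  have step: "F y = (1 - u * y) * (1 - v * y) * F (y * r)" for y
  proof -
    have "(\<lambda>n. qseries T c Q y n - (1 - u * y) * (1 - v * y) * qseries T c Q (y * r) n)
        sums (F y - (1 - u * y) * (1 - v * y) * F (y * r))"
      by (intro sums_diff sums_mult sums)
    then have "0 = F y - (1 - u * y) * (1 - v * y) * F (y * r)"
      by (rule sums_unique2[OF eq[of y]])
    then show ?thesis by simp
  qed
  have iter: "F x = qpoch (u * x) r N * qpoch (v * x) r N * F (x * r ^ N)" for N
  proof (induction N)
    case (Suc N)
    show ?case
      unfolding Suc.IH step[of "x * r ^ N"] by (simp add: qpoch_Suc mult_ac)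
  qed simp
  have "(\<lambda>N. x * r ^ N) \<longlonglongrightarrow> x * 0"
    using r by (intro tendsto_intros LIMSEQ_power_zero)
  then have "(\<lambda>N. F (x * r ^ N)) \<longlonglongrightarrow> 1"
    unfolding F_def by (intro suminf_qseries_tendsto_one[OF Q T T0]) simp
  then have "(\<lambda>N. qpoch (u * x) r N * qpoch (v * x) r N * F (x * r ^ N))
      \<longlonglongrightarrow> qpoch_inf (u * x) r * qpoch_inf (v * x) r * 1"
    by (intro tendsto_intros qpoch_tendsto r)
  moreover have "(\<lambda>N. qpoch (u * x) r N * qpoch (v * x) r N * F (x * r ^ N)) = (\<lambda>N. F x)"
    by (rule ext, rule iter[symmetric])
  ultimately have "F x = qpoch_inf (u * x) r * qpoch_inf (v * x) r"
    by (simp add: LIMSEQ_const_iff)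
  with sums[of x] show ?thesis by simp
qed

text \<open>Here \<open>h\<close> is the telescoping certificate. The boundary term at 0 vanishes
  because \<open>h 0 = 0\<close>, and the one at infinity because \<open>T n * x ^ n\<close> tends
  to 0 while \<open>h\<close> converges.\<close>

lemma qseries_telescope:
  fixes T :: "nat \<Rightarrow> complex" and Q x :: complex
  assumes Q: "norm Q < 1" and T: "\<And>n. norm (T n) \<le> norm Q ^ (n choose 2) * K ^ n"
    and h: "h \<longlonglongrightarrow> l" and h0: "h 0 = 0"
    and eq: "\<And>n. f n = T n * x ^ n * h n - T (Suc n) * x ^ Suc n * h (Suc n)"
  shows "f sums 0"
proof -
  \<comment> \<open>With \<open>c = 0\<close> the infinite product is 1, so this is the bare power
    series.\<close>
  have "summable (\<lambda>n. qseries T 0 Q x n)"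
    by (intro summable_norm_cancel[OF summable_norm_qseries[OF Q T]])
  then have "(\<lambda>n. T n * x ^ n) \<longlonglongrightarrow> 0"
    using summable_LIMSEQ_zero by (fastforce simp: qseries_def)
  then have "(\<lambda>n. T n * x ^ n * h n) \<longlonglongrightarrow> 0 * l"
    by (intro tendsto_mult h)
  from telescope_sums'[OF this] show ?thesis
    by (simp add: h0 eq[abs_def])
qed

lemma tendsto_qpoch_inf_shift:
  assumes "norm Q < 1"
  shows "(\<lambda>n. qpoch_inf (y * Q ^ n) Q) \<longlonglongrightarrow> 1"
proof -
  have "(\<lambda>n. y * Q ^ n) \<longlonglongrightarrow> y * 0"
    using assms by (intro tendsto_intros LIMSEQ_power_zero)
  then show ?thesis by (intro qpoch_inf_tendsto_one assms) simp
qed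

lemma one_minus_power_nonzero:
  assumes "norm (Q :: complex) < 1" "n > 0"
  shows "1 - Q ^ n \<noteq> 0"
proof
  assume "1 - Q ^ n = 0"
  then have "norm (Q ^ n) = 1" by simp
  moreover have "norm Q ^ n < 1"
    using assms by (simp add: power_less_one_iff)
  ultimately show False by (simp add: norm_power)
qed

section \<open>Summation theorems\<close>

text \<open>The \<open>\<^sub>1\<phi>\<^sub>1\<close> summation, multiplied by \<open>(a x; Q)\<^sub>\<infinity>\<close>. Writing \<open>t\<^sub>m\<close> for the summand at \<open>x\<close>, the difference
  with \<open>1 - x\<close> times the summand at \<open>x Q\<close> telescopes with the certificate \<open>(1 - Q^m) t\<^sub>m\<close>.\<close>

lemma one_phi_one_sum:
  assumes Q: "norm Q < 1"
  shows "(\<lambda>m. (-1) ^ m * Q ^ (m choose 2) * qpoch a Q m / qpoch Q Q m * x ^ m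
      * qpoch_inf (a * x * Q ^ m) Q) sums qpoch_inf x Q"
proof -
  define T where "T m = (-1) ^ m * Q ^ (m choose 2) * qpoch a Q m / qpoch Q Q m" for m
  define K where "K = (1 + norm a) * (1 / (1 - norm Q))"
  have T: "norm (T n) \<le> norm Q ^ (n choose 2) * K ^ n" for n
  proof -
    have "norm (qpoch a Q n) * norm (1 / qpoch Q Q n) \<le> (1 + norm a) ^ n * (1 / (1 - norm Q)) ^ n"
      using norm_qpoch_le[OF Q] norm_inverse_qpoch_le[OF Q] by (intro mult_mono) auto
    then show ?thesis
      unfolding K_def power_mult_distrib
      using mult_left_mono[of _ _ "norm Q ^ (n choose 2)"]
      by (fastforce simp: T_def norm_mult norm_divide norm_power)
  qed
  \<comment> \<open>The term ratio in cleared form: the certificate at \<open>Suc m\<close> supplies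
    exactly the factor \<open>1 - Q ^ Suc m\<close>, so no quotient survives.\<close>
  have T_Suc: "T (Suc m) * (1 - Q ^ Suc m) = - T m * Q ^ m * (1 - a * Q ^ m)" for m
    using one_minus_power_nonzero[OF Q, of "Suc m"]
    by (simp add: T_def qpoch_Suc numeral_2_eq_2 power_add)
  have step: "qpoch_inf (a * x * Q ^ m) Q = (1 - a * x * Q ^ m) * qpoch_inf (a * x * Q ^ Suc m) Q" for x m
    using qpoch_inf_step[OF Q, of "a * x * Q ^ m"] by (simp add: mult_ac)
  \<comment> \<open>The choice \<open>u = 1\<close>, \<open>v = 0\<close> gives a single product,
    with shift \<open>Q\<close>.\<close>
  have "(\<lambda>n. qseries T a Q x n - (1 - 1 * x) * (1 - 0 * x) * qseries T a Q (x * Q) n) sums 0" for x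
  proof (rule qseries_telescope[OF Q T])
    have "(\<lambda>n. (1 - Q ^ n) * qpoch_inf (a * x * Q ^ n) Q) \<longlonglongrightarrow> (1 - 0) * 1"
      using Q by (intro tendsto_intros LIMSEQ_power_zero tendsto_qpoch_inf_shift)
    then show "(\<lambda>n. (1 - Q ^ n) * qpoch_inf (a * x * Q ^ n) Q) \<longlonglongrightarrow> 1" by simp
    fix m
    have "T (Suc m) * x ^ Suc m * ((1 - Q ^ Suc m) * qpoch_inf (a * x * Q ^ Suc m) Q)
        = - T m * Q ^ m * (1 - a * Q ^ m) * x ^ Suc m * qpoch_inf (a * x * Q ^ Suc m) Q"
      unfolding T_Suc[symmetric] by (simp only: mult_ac)
    moreover have "qseries T a Q (x * Q) m = T m * x ^ m * Q ^ m * qpoch_inf (a * x * Q ^ Suc m) Q"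
      by (simp add: qseries_def power_mult_distrib mult_ac)
    ultimately show "qseries T a Q x m - (1 - 1 * x) * (1 - 0 * x) * qseries T a Q (x * Q) m
        = T m * x ^ m * ((1 - Q ^ m) * qpoch_inf (a * x * Q ^ m) Q)
          - T (Suc m) * x ^ Suc m * ((1 - Q ^ Suc m) * qpoch_inf (a * x * Q ^ Suc m) Q)"
      unfolding qseries_def step[of x m] by (simp add: algebra_simps del: power_Suc) (simp add: algebra_simps)
  qed simp
  from qseries_sums_of_functional_equation[OF Q T _ Q this]
  show ?thesis by (simp add: qseries_def[abs_def] T_def numeral_2_eq_2)
qed

text \<open>The case \<open>a = 0\<close> of \<open>one_phi_one_sum\<close> at \<open>- z\<close>:
  the two signs cancel and the extra infinite product is 1.\<close>

lemma euler_sum: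
  assumes "norm Q < 1"
  shows "(\<lambda>k. Q ^ (k choose 2) / qpoch Q Q k * z ^ k) sums qpoch_inf (- z) Q"
proof -
  have "qpoch 0 Q k = 1" for k by (simp add: qpoch_def)
  moreover have "(-1) ^ k * (- z) ^ k = z ^ k" for k :: nat
    by (simp flip: power_mult_distrib)
  ultimately have "(-1) ^ k * Q ^ (k choose 2) * qpoch 0 Q k / qpoch Q Q k * (- z) ^ k
      * qpoch_inf (0 * - z * Q ^ k) Q = Q ^ (k choose 2) / qpoch Q Q k * z ^ k" for k
    by (simp add: mult.left_commute[of _ "(- z) ^ k"])
  then show ?thesis
    using one_phi_one_sum[OF assms, of 0 "- z"] by (simp only:)
qed

text \<open>Andrews' \<open>q\<close>-analogue of Bailey's theorem, multiplied by \<open>(b; Q)\<^sub>\<infinity>\<close>. It is usually stated with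
  \<open>a' = Q / a\<close>.\<close>

lemma bailey_sum:
  assumes Q: "norm Q < 1" and aa': "a * a' = Q"
  shows "(\<lambda>n. Q ^ (n choose 2) * qpoch a Q n * qpoch a' Q n / qpoch (Q ^ 2) (Q ^ 2) n * b ^ n
      * qpoch_inf (b * Q ^ n) Q) sums (qpoch_inf (a * b) (Q ^ 2) * qpoch_inf (a' * b) (Q ^ 2))"
proof -
  define T where "T n = Q ^ (n choose 2) * qpoch a Q n * qpoch a' Q n / qpoch (Q ^ 2) (Q ^ 2) n" for n
  define K where "K = (1 + norm a) * (1 + norm a') * (1 / (1 - norm (Q ^ 2)))"
  have Q2: "norm (Q ^ 2) < 1"
    using Q by (simp add: norm_power power_less_one_iff)
  have T: "norm (T n) \<le> norm Q ^ (n choose 2) * K ^ n" for n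
  proof -
    have "norm (qpoch a Q n) * norm (qpoch a' Q n) * norm (1 / qpoch (Q ^ 2) (Q ^ 2) n)
        \<le> (1 + norm a) ^ n * (1 + norm a') ^ n * (1 / (1 - norm (Q ^ 2))) ^ n"
      by (intro mult_mono norm_qpoch_le[OF Q] norm_inverse_qpoch_le[OF Q2]) auto
    then show ?thesis
      unfolding K_def power_mult_distrib
      using mult_left_mono[of _ _ "norm Q ^ (n choose 2)"]
      by (fastforce simp: T_def norm_mult norm_divide norm_power)
  qed
  have T_Suc: "T (Suc n) * (1 - Q ^ (2 * Suc n)) = T n * Q ^ n * (1 - a * Q ^ n) * (1 - a' * Q ^ n)" for n
  proof -
    have "Q ^ 2 * (Q ^ 2) ^ n = Q ^ (2 * Suc n)"
      by (simp add: power_mult power2_eq_square)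
    then show ?thesis
      using one_minus_power_nonzero[OF Q, of "2 * Suc n"]
      by (simp add: T_def qpoch_Suc numeral_2_eq_2 power_add del: power_Suc mult_Suc_right)
  qed
  have step: "qpoch_inf (x * Q ^ n) Q = (1 - x * Q ^ n) * qpoch_inf (x * Q ^ Suc n) Q" for x n
    using qpoch_inf_step[OF Q, of "x * Q ^ n"] by (simp add: mult_ac)
  \<comment> \<open>The argument moves by \<open>Q ^ 2\<close>, which is why the products on the
    right have that base. The certificate is \<open>1 - Q ^ (2 * n)\<close> times the infinite
    product started one factor later than in the summand.\<close>
  have "(\<lambda>n. qseries T 1 Q b n - (1 - a * b) * (1 - a' * b) * qseries T 1 Q (b * Q ^ 2) n) sums 0" for b
  proof (rule qseries_telescope[OF Q T])
    have "(\<lambda>n. (1 - Q ^ (2 * n)) * qpoch_inf (b * Q * Q ^ n) Q) \<longlonglongrightarrow> (1 - 0) * 1"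
      unfolding power_mult using Q2
      by (intro tendsto_intros LIMSEQ_power_zero tendsto_qpoch_inf_shift Q)
    then show "(\<lambda>n. (1 - Q ^ (2 * n)) * qpoch_inf (b * Q ^ Suc n) Q) \<longlonglongrightarrow> 1" by (simp add: mult_ac)
    fix n
    \<comment> \<open>\<open>P\<close> is the tail common to all four infinite products involved;
      after dividing out \<open>T n * b ^ n * P\<close>, only polynomials in \<open>X\<close>
      remain.\<close>
    define X P where "X = Q ^ n" and "P = qpoch_inf (b * Q ^ Suc (Suc n)) Q"
    have 1: "T (Suc n) * b ^ Suc n * ((1 - Q ^ (2 * Suc n)) * qpoch_inf (b * Q ^ Suc (Suc n)) Q)
        = T n * b ^ n * P * (b * X * (1 - a * X) * (1 - a' * X))"
      using T_Suc[of n] by (simp add: P_def X_def mult_ac)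
    have 2: "qseries T 1 Q (b * Q ^ 2) n = T n * b ^ n * P * X ^ 2"
      by (simp add: qseries_def P_def X_def power_mult_distrib power2_eq_square mult_ac flip: power_add)
    have 3: "qpoch_inf (b * Q ^ Suc n) Q = (1 - b * Q * X) * P"
      unfolding P_def X_def by (subst step) (simp add: mult_ac)
    have 4: "qseries T 1 Q b n = T n * b ^ n * P * ((1 - b * X) * (1 - b * Q * X))"
      unfolding qseries_def using step[of b n] 3 by (simp add: X_def mult_ac)
    have 5: "Q ^ (2 * n) = X ^ 2" by (simp add: X_def power_mult mult.commute[of 2])
    \<comment> \<open>The two sides agree because of \<open>a * a' = Q\<close>: their difference has
      the factor \<open>Q - a * a'\<close>.\<close>
    have "(1 - b * X) * (1 - b * Q * X) - (1 - a * b) * (1 - a' * b) * X ^ 2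
        = (1 - X ^ 2) * (1 - b * Q * X) - b * X * (1 - a * X) * (1 - a' * X)"
      unfolding aa'[symmetric] by algebra
    then have "T n * b ^ n * P * ((1 - b * X) * (1 - b * Q * X) - (1 - a * b) * (1 - a' * b) * X ^ 2)
        = T n * b ^ n * P * ((1 - X ^ 2) * (1 - b * Q * X) - b * X * (1 - a * X) * (1 - a' * X))"
      by (rule arg_cong)
    then show "qseries T 1 Q b n - (1 - a * b) * (1 - a' * b) * qseries T 1 Q (b * Q ^ 2) n
        = T n * b ^ n * ((1 - Q ^ (2 * n)) * qpoch_inf (b * Q ^ Suc n) Q)
          - T (Suc n) * b ^ Suc n * ((1 - Q ^ (2 * Suc n)) * qpoch_inf (b * Q ^ Suc (Suc n)) Q)"
      unfolding 1 2 3 4 5 by (simp add: right_diff_distrib mult_ac)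
  qed simp
  from qseries_sums_of_functional_equation[OF Q T _ Q2 this]
  show ?thesis by (simp add: qseries_def[abs_def] T_def numeral_2_eq_2)
qed

section \<open>Reduction of the double sums\<close>

text \<open>Turns an iterated sum into an unconditional one over pairs. As \<open>z m\<close> stays
  in the unit disc and \<open>w\<close> is bounded, the inner terms have a majorant
  \<open>D k\<close> that does not depend on \<open>m\<close>.\<close>

lemma has_sum_double_series:
  fixes A :: "nat \<Rightarrow> complex"
  assumes p: "norm p < 1" and A: "summable (\<lambda>m. norm (A m))"
    and z: "\<And>m. norm (z m) \<le> 1" and w: "\<And>m k. norm (w m k) \<le> C"
    and inner: "\<And>m. (\<lambda>k. p ^ (k choose 2) / qpoch p p k * z m ^ k * w m k) sums B m"
    and outer: "(\<lambda>m. A m * B m) sums S"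
  shows "((\<lambda>(m, k). A m * (p ^ (k choose 2) / qpoch p p k * z m ^ k * w m k)) has_sum S) UNIV"
proof -
  define c where "c m k = p ^ (k choose 2) / qpoch p p k * z m ^ k * w m k" for m k
  define D where "D k = norm p ^ (k choose 2) * (1 / (1 - norm p)) ^ k * C" for k
  have C: "0 \<le> C" using w[of 0 0] norm_ge_zero order_trans by blast
  have D: "summable D"
    unfolding D_def using p by (intro summable_mult2 summable_power_choose_two) auto
  have D_nonneg: "0 \<le> D k" for k
    using p C by (simp add: D_def)
  have cD: "norm (c m k) \<le> D k" for m k
  proof -
    have "norm (p ^ (k choose 2)) * norm (1 / qpoch p p k) * norm (z m ^ k) * norm (w m k)
        \<le> norm p ^ (k choose 2) * (1 / (1 - norm p)) ^ k * 1 * C"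
      using p z w norm_inverse_qpoch_le[OF p, of k]
      by (intro mult_mono) (auto simp: norm_power power_le_one)
    then show ?thesis
      by (simp add: c_def D_def norm_mult norm_divide mult_ac)
  qed
  have c_summable: "summable (\<lambda>k. norm (c m k))" for m
    by (rule summable_comparison_test'[OF D]) (simp add: cD)
  have B: "norm (B m) \<le> suminf D" for m
  proof -
    have "norm (B m) = norm (\<Sum>k. c m k)"
      using sums_unique[OF inner[of m]] by (simp add: c_def)
    also have "\<dots> \<le> (\<Sum>k. norm (c m k))"
      by (rule summable_norm[OF c_summable])
    also have "\<dots> \<le> suminf D"
      by (rule suminf_le[OF cD c_summable D])
    finally show ?thesis .
  qed
  have AB: "summable (\<lambda>m. norm (A m * B m))"
  proof (rule summable_comparison_test')
    show "summable (\<lambda>m. norm (A m) * suminf D)" by (rule summable_mult2[OF A])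
    show "norm (norm (A m * B m)) \<le> norm (A m) * suminf D" for m
      using B by (simp add: norm_mult mult_left_mono)
  qed
  have D_has: "(D has_sum suminf D) UNIV"
    using D D_nonneg by (intro norm_summable_imp_has_sum) (auto simp: summable_sums)
  \<comment> \<open>The majorant is a product of a summable function of \<open>m\<close> and one of
    \<open>k\<close>.\<close>
  have "(\<lambda>x. norm (case x of (m, k) \<Rightarrow> norm (A m) * D k)) summable_on UNIV \<times> UNIV"
  proof (subst Infinite_Sum.abs_summable_on_Sigma_iff, intro conjI ballI)
    show "(\<lambda>k. norm (case (m, k) of (m, k) \<Rightarrow> norm (A m) * D k)) summable_on UNIV" for m
      using has_sum_imp_summable[OF has_sum_cmult_right[OF D_has]] D_nonneg by (simp add: abs_mult)
    have "(\<Sum>\<^sub>\<infinity>k. norm (A m) * D k) = norm (A m) * suminf D" for m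
      by (intro infsumI has_sum_cmult_right D_has)
    moreover have "(\<lambda>m. norm (A m) * suminf D) summable_on UNIV"
      using norm_summable_imp_summable_on[of "\<lambda>m. norm (A m) * suminf D"] summable_mult2[OF A] 
        suminf_nonneg[OF D D_nonneg] by (simp add: abs_mult)
    ultimately show "(\<lambda>m. norm (\<Sum>\<^sub>\<infinity>k. norm (case (m, k) of (m, k) \<Rightarrow> norm (A m) * D k))) summable_on UNIV"
      using D_nonneg suminf_nonneg[OF D D_nonneg] by (simp add: abs_mult)
  qed
  then have "(\<lambda>x. norm (case x of (m, k) \<Rightarrow> A m * c m k)) summable_on UNIV \<times> UNIV"
    by (rule Infinite_Sum.abs_summable_on_comparison_test)
      (use cD D_nonneg in \<open>auto simp: norm_mult abs_mult mult_left_mono\<close>)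
  then have summable: "(\<lambda>(m, k). A m * c m k) summable_on UNIV \<times> UNIV"
    by (rule Infinite_Sum.abs_summable_summable)
  have "((\<lambda>(m, k). A m * c m k) has_sum S) (UNIV \<times> UNIV)"
  proof (rule has_sum_SigmaI[OF _ _ summable])
    show "((\<lambda>m. A m * B m) has_sum S) UNIV"
      by (rule norm_summable_imp_has_sum[OF AB outer])
    show "((\<lambda>k. case (m, k) of (m, k) \<Rightarrow> A m * c m k) has_sum A m * B m) UNIV" for m
      using has_sum_cmult_right[OF norm_summable_imp_has_sum[OF c_summable inner[folded c_def]]]
      by simp
  qed
  then show ?thesis by (simp add: c_def)
qed

text \<open>The substitution \<open>n = 2 * m + k\<close> is injective and reaches exactly the pairs
  with \<open>n\<close> at least \<open>2 * m\<close>; elsewhere the summand is 0.\<close>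

lemma has_sum_shift_double:
  fixes f :: "nat \<times> nat \<Rightarrow> complex"
  assumes "((\<lambda>(m, k). f (2 * m + k, m)) has_sum S) UNIV"
    and "\<And>n m. n < 2 * m \<Longrightarrow> f (n, m) = 0"
  shows "(f has_sum S) UNIV"
proof -
  define h where "h = (\<lambda>(m, k). (2 * m + k, m :: nat))"
  have "inj h" by (auto simp: inj_def h_def)
  moreover have "f \<circ> h = (\<lambda>(m, k). f (2 * m + k, m))"
    by (auto simp: h_def)
  ultimately have "(f has_sum S) (range h)"
    using assms(1) by (simp add: has_sum_reindex)
  moreover have "f x = 0" if "x \<notin> range h" for x
  proof -
    obtain n m where x: "x = (n, m)" by (cases x)
    have "n < 2 * m"
    proof (rule ccontr)
      assume "\<not> n < 2 * m"
      then have "x = h (m, n - 2 * m)" by (simp add: h_def x)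
      then show False using that by blast
    qed
    then show ?thesis using assms(2) x by simp
  qed
  ultimately show ?thesis
    by (subst has_sum_cong_neutral[where T = "range h" and g = f]) auto
qed

section \<open>Binomial exponents\<close>

lemma binom2_of_nat: "binom2 (int n) = int (n choose 2)"
proof -
  have "int n * (int n - 1) = int (n * (n - 1))"
    by (cases n) (simp_all add: algebra_simps)
  then show ?thesis by (simp only: binom2_def choose_two zdiv_int of_nat_numeral)
qed

lemma Suc_choose_two: "Suc n choose 2 = n + (n choose 2)"
  by (simp add: numeral_2_eq_2)

lemma binom2_of_nat_plus_one: "binom2 (int n + 1) = int (n choose 2) + int n"
  using binom2_of_nat[of "Suc n"] by (simp add: Suc_choose_two add.commute)

lemma choose_two_shift: "(2 * m + k) choose 2 = 4 * (m choose 2) + m + 2 * m * k + (k choose 2)"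
proof (induction k)
  case 0
  show ?case by (induction m) (simp_all add: Suc_choose_two)
next
  case (Suc k)
  then show ?case by (simp add: Suc_choose_two)
qed

lemma pronic_eq_choose_two: "m * (m + 1) = 2 * (m choose 2) + 2 * (m :: nat)"
  by (induction m) (simp_all add: Suc_choose_two)

section \<open>Inner sums\<close>

text \<open>A factor \<open>p ^ k\<close> moves the Euler argument from \<open>z\<close> to
  \<open>z * p\<close>. Since the product at \<open>- z\<close> is \<open>1 + z\<close> times the
  one at \<open>- (z * p)\<close>, the coefficients combine to
  \<open>(1 + z) - 1 - t\<close>.\<close>

lemma inner_sum_two_term:
  assumes "norm p < 1"
  shows "(\<lambda>k. p ^ (k choose 2) / qpoch p p k * z ^ k * (1 - p ^ k - t * p ^ k))
    sums ((z - t) * qpoch_inf (- (z * p)) p)"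
proof -
  define c where "c k = p ^ (k choose 2) / qpoch p p k * z ^ k" for k
  have 0: "c sums qpoch_inf (- z) p"
    unfolding c_def by (rule euler_sum[OF assms])
  have 1: "(\<lambda>k. c k * p ^ k) sums qpoch_inf (- (z * p)) p"
    using euler_sum[OF assms, of "z * p"] by (simp add: c_def power_mult_distrib mult_ac)
  have "(\<lambda>k. c k - c k * p ^ k - t * (c k * p ^ k))
      sums (qpoch_inf (- z) p - qpoch_inf (- (z * p)) p - t * qpoch_inf (- (z * p)) p)"
    by (intro sums_diff sums_mult 0 1)
  moreover have "qpoch_inf (- z) p - qpoch_inf (- (z * p)) p - t * qpoch_inf (- (z * p)) p
      = (z - t) * qpoch_inf (- (z * p)) p"
    using qpoch_inf_step[OF assms, of "- z"] by (simp add: algebra_simps)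
  moreover have "c k - c k * p ^ k - t * (c k * p ^ k) = c k * (1 - p ^ k - t * p ^ k)" for k
    by (simp add: algebra_simps)
  ultimately show ?thesis
    unfolding c_def by (simp only:)
qed

text \<open>Three Euler products, at \<open>z\<close>, \<open>z * p\<close> and
  \<open>z * p ^ 2\<close>, are all multiples of the last one. The weight is such that the common
  factor \<open>1 + z\<close> comes out and the rest reduces to \<open>- z\<close>.\<close>

lemma inner_sum_three_term:
  assumes "norm p < 1" "p \<noteq> 0"
  shows "(\<lambda>k. p ^ (k choose 2) / qpoch p p k * z ^ k * (1 + (1 + z) / p * ((p ^ k) ^ 2 - (1 + p) * p ^ k)))
    sums (- z * (1 + z) * qpoch_inf (- (z * p ^ 2)) p)"
proof -
  define c where "c k = p ^ (k choose 2) / qpoch p p k * z ^ k" for k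
  have 0: "c sums qpoch_inf (- z) p"
    unfolding c_def by (rule euler_sum[OF assms(1)])
  have 1: "(\<lambda>k. c k * p ^ k) sums qpoch_inf (- (z * p)) p"
    using euler_sum[OF assms(1), of "z * p"] by (simp add: c_def power_mult_distrib mult_ac)
  have 2: "(\<lambda>k. c k * (p ^ k) ^ 2) sums qpoch_inf (- (z * p ^ 2)) p"
    using euler_sum[OF assms(1), of "z * p ^ 2"]
    by (simp add: c_def power_mult_distrib mult_ac flip: power_mult)
  have "(\<lambda>k. c k + ((1 + z) / p) * (c k * (p ^ k) ^ 2 - (1 + p) * (c k * p ^ k)))
      sums (qpoch_inf (- z) p + ((1 + z) / p) * (qpoch_inf (- (z * p ^ 2)) p - (1 + p) * qpoch_inf (- (z * p)) p))"
    by (intro sums_add sums_diff sums_mult 0 1 2)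
  moreover have "c k + ((1 + z) / p) * (c k * (p ^ k) ^ 2 - (1 + p) * (c k * p ^ k))
      = c k * (1 + (1 + z) / p * ((p ^ k) ^ 2 - (1 + p) * p ^ k))" for k
    by (simp add: algebra_simps)
  moreover have "qpoch_inf (- z) p + ((1 + z) / p) * (qpoch_inf (- (z * p ^ 2)) p - (1 + p) * qpoch_inf (- (z * p)) p)
      = - z * (1 + z) * qpoch_inf (- (z * p ^ 2)) p"
  proof -
    define P where "P = qpoch_inf (- (z * p ^ 2)) p"
    have P1: "qpoch_inf (- (z * p)) p = (1 + z * p) * P"
      using qpoch_inf_step[OF assms(1), of "- (z * p)"]
      by (simp add: P_def power2_eq_square mult.assoc)
    have "qpoch_inf (- z) p = (1 + z) * ((1 + z * p) * P)"
      using qpoch_inf_step[OF assms(1), of "- z"] by (simp add: P1)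
    then show ?thesis
      unfolding P1 P_def[symmetric] using assms(2) by (simp add: field_simps)
  qed
  ultimately show ?thesis
    unfolding c_def by (simp only:)
qed

section \<open>Outer sums\<close>

text \<open>The tail of the product at \<open>- Q\<close> equals the whole product divided by
  \<open>qpoch (- Q) Q m\<close>, and this divisor completes \<open>qpoch Q Q m\<close> to the
  denominator \<open>qpoch (Q ^ 2) (Q ^ 2) m\<close> of \<open>bailey_sum\<close>.\<close>

lemma outer_sum_bailey:
  assumes Q: "norm Q < 1" and aa': "a * a' = Q"
  shows "(\<lambda>m. Q ^ (m choose 2) * b ^ m * qpoch a Q m * qpoch a' Q m / qpoch Q Q m
      * (qpoch_inf (b * Q ^ m) Q * qpoch_inf (- Q * Q ^ m) Q))
    sums (qpoch_inf (- Q) Q * (qpoch_inf (a * b) (Q ^ 2) * qpoch_inf (a' * b) (Q ^ 2)))"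
proof -
  have "Q ^ (m choose 2) * b ^ m * qpoch a Q m * qpoch a' Q m / qpoch Q Q m
        * (qpoch_inf (b * Q ^ m) Q * qpoch_inf (- Q * Q ^ m) Q)
      = qpoch_inf (- Q) Q * (Q ^ (m choose 2) * qpoch a Q m * qpoch a' Q m / qpoch (Q ^ 2) (Q ^ 2) m * b ^ m
        * qpoch_inf (b * Q ^ m) Q)" for m
  proof -
    have "qpoch (- Q) Q m \<noteq> 0" using Q by (intro qpoch_nonzero) auto
    then show ?thesis
      unfolding qpoch_square qpoch_inf_split[OF Q, of "- Q" m] by simp
  qed
  then show ?thesis
    using sums_mult[OF bailey_sum[OF Q aa', of b], of "qpoch_inf (- Q) Q"] by (simp only:)
qed

text \<open>The finite symbol at \<open>a'\<close> and the tail at \<open>a' * Q ^ m\<close> form an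
  infinite product free of \<open>m\<close>, which leaves the sum.\<close>

lemma outer_sum_one_phi_one:
  assumes Q: "norm Q < 1"
  shows "(\<lambda>m. (-1) ^ m * Q ^ (m choose 2) * x ^ m * qpoch a Q m * qpoch a' Q m / qpoch Q Q m
      * (qpoch_inf (a' * Q ^ m) Q * qpoch_inf (a * x * Q ^ m) Q))
    sums (qpoch_inf a' Q * qpoch_inf x Q)"
proof -
  have "(-1) ^ m * Q ^ (m choose 2) * x ^ m * qpoch a Q m * qpoch a' Q m / qpoch Q Q m
        * (qpoch_inf (a' * Q ^ m) Q * qpoch_inf (a * x * Q ^ m) Q)
      = qpoch_inf a' Q * ((-1) ^ m * Q ^ (m choose 2) * qpoch a Q m / qpoch Q Q m * x ^ m
        * qpoch_inf (a * x * Q ^ m) Q)" for m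
    unfolding qpoch_inf_split[OF Q, of a' m] by simp
  then show ?thesis
    using sums_mult[OF one_phi_one_sum[OF Q, of a x], of "qpoch_inf a' Q"] by (simp only:)
qed

lemma summable_norm_outer:
  assumes Q: "norm Q < 1"
  shows "summable (\<lambda>m. norm (s * (Q ^ (m choose 2) * y ^ m * qpoch a Q m * qpoch a' Q m / qpoch Q Q m)))"
proof (rule summable_comparison_test')
  define K where "K = norm y * (1 + norm a) * (1 + norm a') * (1 / (1 - norm Q))"
  have "0 \<le> K" using Q by (simp add: K_def)
  then show "summable (\<lambda>m. norm s * (norm Q ^ (m choose 2) * K ^ m))"
    using Q by (intro summable_mult summable_power_choose_two) auto
  fix m
  have "norm y ^ m * norm (qpoch a Q m) * norm (qpoch a' Q m) * norm (1 / qpoch Q Q m)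
      \<le> norm y ^ m * (1 + norm a) ^ m * (1 + norm a') ^ m * (1 / (1 - norm Q)) ^ m"
    by (intro mult_mono norm_qpoch_le[OF Q] norm_inverse_qpoch_le[OF Q]) auto
  then have "norm s * norm Q ^ (m choose 2) * (norm y ^ m * norm (qpoch a Q m) * norm (qpoch a' Q m) * norm (1 / qpoch Q Q m))
      \<le> norm s * norm Q ^ (m choose 2) * K ^ m"
    unfolding K_def power_mult_distrib by (intro mult_left_mono) auto
  then show "norm (norm (s * (Q ^ (m choose 2) * y ^ m * qpoch a Q m * qpoch a' Q m / qpoch Q Q m)))
      \<le> norm s * (norm Q ^ (m choose 2) * K ^ m)"
    by (simp add: norm_mult norm_divide norm_power mult_ac)
qed

lemma double_coeff_shift:
  "double_coeff q (2 * m + k) m = qpoch (- q) (q ^ 6) m * qpoch (- (q ^ 5)) (q ^ 6) m / qpoch (q ^ 6) (q ^ 6) m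
    / qpoch (q ^ 3) (q ^ 3) k"
  by (simp add: double_coeff_def inv_qpoch_int_def)

lemma double_coeff_eq_0: "n < 2 * m \<Longrightarrow> double_coeff q n m = 0"
  by (simp add: double_coeff_def inv_qpoch_int_def)

text \<open>Euler's identity between partitions into distinct parts and into odd parts, in product
  form.\<close>

lemma qpoch_inf_minus_eq_inverse:
  assumes "norm Q < 1"
  shows "qpoch_inf (- Q) Q * x = x / qpoch_inf Q (Q ^ 2)"
proof -
  have Q2: "norm (Q ^ 2) < 1"
    using assms by (simp add: norm_power power_less_one_iff)
  have "qpoch_inf (- Q) Q * qpoch_inf Q (Q ^ 2) * qpoch_inf (Q ^ 2) (Q ^ 2)
      = 1 * qpoch_inf (Q ^ 2) (Q ^ 2)"
    using qpoch_inf_dissect[OF assms, of Q] qpoch_inf_square[OF assms, of Q]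
    by (simp add: power2_eq_square mult_ac)
  then have "qpoch_inf (- Q) Q * qpoch_inf Q (Q ^ 2) = 1"
    using qpoch_inf_nonzero[OF Q2 Q2] by simp
  moreover have "qpoch_inf Q (Q ^ 2) \<noteq> 0"
    by (rule qpoch_inf_nonzero[OF assms Q2])
  ultimately show ?thesis by (simp add: field_simps)
qed

text \<open>Common frame for the four identities: \<open>s\<close> is the overall constant,
  \<open>y\<close> the extra base raised to \<open>m\<close>, \<open>z\<close> the Euler argument at
  \<open>m = 0\<close>, and \<open>w\<close> the weight. What remains is the inner sum for each
  \<open>m\<close> and one outer sum.\<close>

lemma has_sum_double_coeff:
  fixes q :: complex
  assumes q: "norm q < 1" and z: "norm z \<le> 1" and w: "\<And>m k. norm (w m k) \<le> C"
    and f: "\<And>m k. f (2 * m + k, m) = s * (q ^ 6) ^ (m choose 2) * y ^ m * (q ^ 3) ^ (k choose 2)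
      * (z * (q ^ 6) ^ m) ^ k * double_coeff q (2 * m + k) m * w m k"
    and f0: "\<And>n m. n < 2 * m \<Longrightarrow> f (n, m) = 0"
    and inner: "\<And>m. (\<lambda>k. (q ^ 3) ^ (k choose 2) / qpoch (q ^ 3) (q ^ 3) k * (z * (q ^ 6) ^ m) ^ k * w m k) sums B m"
    and outer: "(\<lambda>m. s * ((q ^ 6) ^ (m choose 2) * y ^ m * qpoch (- q) (q ^ 6) m * qpoch (- (q ^ 5)) (q ^ 6) m
      / qpoch (q ^ 6) (q ^ 6) m) * B m) sums S"
  shows "(f has_sum S) UNIV"
proof (rule has_sum_shift_double[where f = f, OF _ f0])
  have less: "norm (q ^ 3) < 1" "norm (q ^ 6) < 1"
    using q by (simp_all add: norm_power power_less_one_iff)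
  have zm: "norm (z * (q ^ 6) ^ m) \<le> 1" for m
    using z less by (simp add: norm_mult norm_power mult_le_one power_le_one)
  have "((\<lambda>(m, k). s * ((q ^ 6) ^ (m choose 2) * y ^ m * qpoch (- q) (q ^ 6) m * qpoch (- (q ^ 5)) (q ^ 6) m
      / qpoch (q ^ 6) (q ^ 6) m) * ((q ^ 3) ^ (k choose 2) / qpoch (q ^ 3) (q ^ 3) k * (z * (q ^ 6) ^ m) ^ k * w m k))
      has_sum S) UNIV"
    by (rule has_sum_double_series[OF less(1) summable_norm_outer[OF less(2)] zm w inner outer])
  then show "((\<lambda>(m, k). f (2 * m + k, m)) has_sum S) UNIV"
    by (simp only: f double_coeff_shift) (simp add: mult_ac)
qed

section \<open>Exponents and weights in the variables m and k\<close>

lemma exponent_shift: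
  "3 * binom2 (int (2 * m + k)) - 3 * int m * (int m + 1)
    = int (6 * (m choose 2) + 6 * m * k + 3 * (k choose 2)) - 3 * int m"
proof -
  have "int m * (int m + 1) = 2 * int (m choose 2) + 2 * int m"
    using arg_cong[OF pronic_eq_choose_two[of m], of int] by (simp add: distrib_left)
  then show ?thesis
    unfolding binom2_of_nat choose_two_shift mult.assoc[of 3 "int m"] by simp
qed

text \<open>The mixed exponent \<open>6 * m * k\<close> is what scales the Euler argument by
  \<open>(q ^ 6) ^ m\<close>.\<close>

lemma power_exponent_shift:
  fixes q :: complex
  shows "q ^ (6 * (m choose 2) + 6 * m * k + 3 * (k choose 2) + u * m + v * k)
    = (q ^ 6) ^ (m choose 2) * (q ^ u) ^ m * (q ^ 3) ^ (k choose 2) * (q ^ v * (q ^ 6) ^ m) ^ k"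
  by (simp only: power_add power_mult power_mult_distrib) (simp only: mult_ac)

lemma powi_exponent_shift:
  fixes q :: complex
  assumes "e = int (6 * (m choose 2) + 6 * m * k + 3 * (k choose 2) + u * m + v * k) - 1" and "q \<noteq> 0"
  shows "q powi e
    = (q ^ 6) ^ (m choose 2) * (q ^ u) ^ m * (q ^ 3) ^ (k choose 2) * (q ^ v * (q ^ 6) ^ m) ^ k / q"
  unfolding assms(1) by (simp only: power_int_diff[OF disjI1[OF assms(2)]] power_int_of_nat power_exponent_shift power_int_1_right)

text \<open>This is the weight of \<open>inner_sum_two_term\<close> with \<open>p = q ^ 3\<close>
  and \<open>t = q * (q ^ 6) ^ m\<close>.\<close>

lemma weight_shift:
  fixes q :: complex
  shows "1 - q powi (3 * int (2 * m + k) + 1) - q powi (3 * int (2 * m + k) - 6 * int m)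
    = 1 - (q ^ 3) ^ k - q * (q ^ 6) ^ m * (q ^ 3) ^ k"
proof -
  have "3 * int (2 * m + k) + 1 = int (6 * m + 3 * k + 1)"
    and "3 * int (2 * m + k) - 6 * int m = int (3 * k)" by simp_all
  then show ?thesis
    by (simp only: power_int_of_nat) (simp add: power_add power_mult)
qed

lemma norm_weight_le:
  fixes q :: complex
  assumes "norm q < 1"
  shows "norm (1 - (q ^ 3) ^ k - q * (q ^ 6) ^ m * (q ^ 3) ^ k) \<le> 3"
proof -
  have "norm ((q ^ 3) ^ k) \<le> 1" "norm (q * (q ^ 6) ^ m * (q ^ 3) ^ k) \<le> 1"
    using assms by (simp_all add: norm_mult norm_power mult_le_one power_le_one)
  then show ?thesis
    using norm_triangle_ineq4[of 1 "(q ^ 3) ^ k"]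
      norm_triangle_ineq4[of "1 - (q ^ 3) ^ k" "q * (q ^ 6) ^ m * (q ^ 3) ^ k"] by simp
qed

text \<open>This is the weight of \<open>inner_sum_three_term\<close> with \<open>p = q ^ 3\<close>
  and \<open>z = q * (q ^ 6) ^ m\<close>.\<close>

lemma weight_shift':
  fixes q :: complex
  assumes "q \<noteq> 0"
  shows "1 + q powi (3 * int (2 * m + k) - 12 * int m - 3) * (1 + q powi (1 + 6 * int m))
      * (q powi (3 * int (2 * m + k)) - q powi (6 * int m) * (1 + q ^ 3))
    = 1 + (1 + q * (q ^ 6) ^ m) / q ^ 3 * (((q ^ 3) ^ k) ^ 2 - (1 + q ^ 3) * (q ^ 3) ^ k)"
proof -
  have "3 * int (2 * m + k) - 12 * int m - 3 = int (3 * k) - int (6 * m) - int 3"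
    and "1 + 6 * int m = int (1 + 6 * m)" and "3 * int (2 * m + k) = int (6 * m + 3 * k)"
    and "6 * int m = int (6 * m)" by simp_all
  then have "q powi (3 * int (2 * m + k) - 12 * int m - 3) = (q ^ 3) ^ k / (q ^ 6) ^ m / q ^ 3"
    and "q powi (1 + 6 * int m) = q * (q ^ 6) ^ m"
    and "q powi (3 * int (2 * m + k)) = (q ^ 6) ^ m * (q ^ 3) ^ k"
    and "q powi (6 * int m) = (q ^ 6) ^ m"
    by (simp_all only: power_int_diff[OF disjI1[OF assms]] power_int_of_nat power_add power_mult power_one_right)
  then show ?thesis
    using assms by (simp only:) (simp add: field_simps power2_eq_square)
qed

lemma norm_weight_le':
  fixes q :: complex
  assumes "norm q < 1"
  shows "norm (1 + (1 + q * (q ^ 6) ^ m) / q ^ 3 * (((q ^ 3) ^ k) ^ 2 - (1 + q ^ 3) * (q ^ 3) ^ k))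
    \<le> 1 + 2 / norm (q ^ 3) * 3"
proof -
  define t u where "t = q * (q ^ 6) ^ m" and "u = (q ^ 3) ^ k"
  have "norm t \<le> 1" "norm u \<le> 1" "norm (q ^ 3) \<le> 1"
    using assms by (simp_all add: t_def u_def norm_mult norm_power mult_le_one power_le_one)
  then have "norm (u ^ 2) \<le> 1" "norm (1 + q ^ 3) \<le> 2" "norm (1 + t) \<le> 2"
    using norm_triangle_ineq[of 1 t] norm_triangle_ineq[of 1 "q ^ 3"]
    by (auto simp: norm_power power_le_one)
  moreover from this have "norm ((1 + q ^ 3) * u) \<le> 2 * 1"
    unfolding norm_mult using \<open>norm u \<le> 1\<close> by (intro mult_mono) auto
  ultimately have "norm (u ^ 2 - (1 + q ^ 3) * u) \<le> 3" "norm ((1 + t) / q ^ 3) \<le> 2 / norm (q ^ 3)"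
    using norm_triangle_ineq4[of "u ^ 2" "(1 + q ^ 3) * u"]
    by (auto simp: norm_divide divide_right_mono)
  then have "norm ((1 + t) / q ^ 3 * (u ^ 2 - (1 + q ^ 3) * u)) \<le> 2 / norm (q ^ 3) * 3"
    unfolding norm_mult by (intro mult_mono) auto
  then show ?thesis
    using norm_triangle_ineq[of 1 "(1 + t) / q ^ 3 * (u ^ 2 - (1 + q ^ 3) * u)"]
    by (simp add: t_def u_def)
qed

lemma qpoch_inf_dissect_cube:
  fixes q :: complex
  assumes "norm q < 1"
  shows "qpoch_inf (- (x * (q ^ 6) ^ m)) (q ^ 3)
    = qpoch_inf (- x * (q ^ 6) ^ m) (q ^ 6) * qpoch_inf (- (x * q ^ 3) * (q ^ 6) ^ m) (q ^ 6)"
proof -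
  have "norm (q ^ 3) < 1"
    using assms by (simp add: norm_power power_less_one_iff)
  from qpoch_inf_dissect[OF this, of "- (x * (q ^ 6) ^ m)"] show ?thesis
    by (simp add: mult_ac flip: power_mult)
qed

lemma power_six_square: "((q :: complex) ^ 6) ^ 2 = q ^ 12"
  by (simp flip: power_mult)

lemma power_six_less_one: "norm (q :: complex) < 1 \<Longrightarrow> norm (q ^ 6) < 1"
  by (simp add: norm_power power_less_one_iff)

section \<open>The four identities\<close>

text \<open>With \<open>Q = q ^ 6\<close>, the inner product splits into tails at
  \<open>- (q ^ 3)\<close> and \<open>- Q\<close>, as \<open>outer_sum_bailey\<close> requires for
  \<open>b = - (q ^ 3)\<close>, \<open>a = - q\<close> and \<open>a' = - (q ^ 5)\<close>. Exponents
  are natural numbers once \<open>n\<close> is at least \<open>2 * m\<close>, so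
  \<open>q = 0\<close> is included.\<close>

lemma first_identity:
  fixes q :: complex
  assumes q: "norm q < 1"
  shows "((\<lambda>(n, m). (-1) ^ m * q powi (3 * binom2 (int n + 1) - 3 * int m * (int m + 1)) * double_coeff q n m)
    has_sum (qpoch_inf (q ^ 4) (q ^ 12) * qpoch_inf (q ^ 8) (q ^ 12) / qpoch_inf (q ^ 6) (q ^ 12)))
    (UNIV :: (nat \<times> nat) set)"
proof (rule has_sum_double_coeff[where s = 1 and y = "- (q ^ 3)" and z = "q ^ 3" and w = "\<lambda>_ _. 1" and C = 1
      and B = "\<lambda>m. qpoch_inf (- (q ^ 3 * (q ^ 6) ^ m)) (q ^ 3)", OF q])
  have Q: "norm (q ^ 6) < 1" by (rule power_six_less_one[OF q])
  have p: "norm (q ^ 3) < 1"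
    using q by (simp add: norm_power power_less_one_iff)
  show "norm (q ^ 3) \<le> 1" using p by simp
  fix m k :: nat
  have "3 * binom2 (int (2 * m + k) + 1) - 3 * int m * (int m + 1)
      = int (6 * (m choose 2) + 6 * m * k + 3 * (k choose 2) + 3 * m + 3 * k)"
    using exponent_shift[of m k] unfolding binom2_of_nat_plus_one binom2_of_nat by simp
  then show "(case (2 * m + k, m) of (n, m) \<Rightarrow>
        (-1) ^ m * q powi (3 * binom2 (int n + 1) - 3 * int m * (int m + 1)) * double_coeff q n m)
      = 1 * (q ^ 6) ^ (m choose 2) * (- (q ^ 3)) ^ m * (q ^ 3) ^ (k choose 2)
        * (q ^ 3 * (q ^ 6) ^ m) ^ k * double_coeff q (2 * m + k) m * 1"
    unfolding prod.case
    by (simp only: power_int_of_nat power_exponent_shift power_minus[of "q ^ 3"]) (simp add: mult_ac)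
  show "(\<lambda>k. (q ^ 3) ^ (k choose 2) / qpoch (q ^ 3) (q ^ 3) k * (q ^ 3 * (q ^ 6) ^ m) ^ k * 1)
      sums qpoch_inf (- (q ^ 3 * (q ^ 6) ^ m)) (q ^ 3)"
    using euler_sum[OF p] by simp
  have 1: "- q * - (q ^ 5) = q ^ 6" "- q * - (q ^ 3) = q ^ 4" "- (q ^ 5) * - (q ^ 3) = q ^ 8"
    "q ^ 3 * q ^ 3 = q ^ 6"
    by (simp_all add: eval_nat_numeral)
  show "(\<lambda>m. 1 * ((q ^ 6) ^ (m choose 2) * (- (q ^ 3)) ^ m * qpoch (- q) (q ^ 6) m * qpoch (- (q ^ 5)) (q ^ 6) m
      / qpoch (q ^ 6) (q ^ 6) m) * qpoch_inf (- (q ^ 3 * (q ^ 6) ^ m)) (q ^ 3))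
      sums (qpoch_inf (q ^ 4) (q ^ 12) * qpoch_inf (q ^ 8) (q ^ 12) / qpoch_inf (q ^ 6) (q ^ 12))"
    using outer_sum_bailey[OF Q 1(1), of "- (q ^ 3)"]
    unfolding 1 qpoch_inf_dissect_cube[OF q] qpoch_inf_minus_eq_inverse[OF Q] power_six_square mult_1 .
qed (simp_all add: double_coeff_eq_0)

text \<open>The inner sum contributes \<open>(q ^ 3 - q) * (q ^ 6) ^ m\<close>. Its constant cancels
  against \<open>- 1 / q\<close> up to \<open>1 - q ^ 2\<close>, and its power of
  \<open>q ^ 6\<close> turns \<open>y = - (q ^ 3)\<close> into \<open>b = - (q ^ 9)\<close>.\<close>

lemma third_identity:
  fixes q :: complex
  assumes q: "norm q < 1" "q \<noteq> 0"
  shows "((\<lambda>(n, m). (-1) ^ (m + 1)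
        * q powi (3 * binom2 (int n + 1) - 3 * int m * (int m + 1) - 1)
        * double_coeff q n m
        * (1 - q powi (3 * int n + 1) - q powi (3 * int n - 6 * int m)))
      has_sum
        (qpoch_inf (q ^ 2) (q ^ 12) * qpoch_inf (q ^ 10) (q ^ 12) / qpoch_inf (q ^ 6) (q ^ 12)))
      (UNIV :: (nat \<times> nat) set)"
proof (rule has_sum_double_coeff[where s = "- 1 / q" and y = "- (q ^ 3)" and z = "q ^ 3" and C = 3
      and w = "\<lambda>m k. 1 - (q ^ 3) ^ k - q * (q ^ 6) ^ m * (q ^ 3) ^ k"
      and B = "\<lambda>m. (q ^ 3 * (q ^ 6) ^ m - q * (q ^ 6) ^ m) * qpoch_inf (- (q ^ 3 * (q ^ 6) ^ m * q ^ 3)) (q ^ 3)",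
      OF q(1)])
  have Q: "norm (q ^ 6) < 1" by (rule power_six_less_one[OF q(1)])
  have p: "norm (q ^ 3) < 1"
    using q by (simp add: norm_power power_less_one_iff)
  show "norm (q ^ 3) \<le> 1" using p by simp
  fix m k :: nat
  show "norm (1 - (q ^ 3) ^ k - q * (q ^ 6) ^ m * (q ^ 3) ^ k) \<le> 3"
    by (rule norm_weight_le[OF q(1)])
  have "3 * binom2 (int (2 * m + k) + 1) - 3 * int m * (int m + 1) - 1
      = int (6 * (m choose 2) + 6 * m * k + 3 * (k choose 2) + 3 * m + 3 * k) - 1"
    using exponent_shift[of m k] unfolding binom2_of_nat_plus_one binom2_of_nat by simp
  note e = powi_exponent_shift[OF this q(2)]
  show "(case (2 * m + k, m) of (n, m) \<Rightarrow> (-1) ^ (m + 1)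
        * q powi (3 * binom2 (int n + 1) - 3 * int m * (int m + 1) - 1)
        * double_coeff q n m * (1 - q powi (3 * int n + 1) - q powi (3 * int n - 6 * int m)))
      = - 1 / q * (q ^ 6) ^ (m choose 2) * (- (q ^ 3)) ^ m * (q ^ 3) ^ (k choose 2)
        * (q ^ 3 * (q ^ 6) ^ m) ^ k * double_coeff q (2 * m + k) m * (1 - (q ^ 3) ^ k - q * (q ^ 6) ^ m * (q ^ 3) ^ k)"
    unfolding prod.case weight_shift e power_minus[of "q ^ 3"] by simp
  show "(\<lambda>k. (q ^ 3) ^ (k choose 2) / qpoch (q ^ 3) (q ^ 3) k * (q ^ 3 * (q ^ 6) ^ m) ^ k
        * (1 - (q ^ 3) ^ k - q * (q ^ 6) ^ m * (q ^ 3) ^ k))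
      sums ((q ^ 3 * (q ^ 6) ^ m - q * (q ^ 6) ^ m) * qpoch_inf (- (q ^ 3 * (q ^ 6) ^ m * q ^ 3)) (q ^ 3))"
    by (rule inner_sum_two_term[OF p])
  have 1: "- q * - (q ^ 5) = q ^ 6" "- q * - (q ^ 9) = q ^ 10" "- (q ^ 5) * - (q ^ 9) = q ^ 2 * q ^ 12"
    "q ^ 3 * q ^ 3 = q ^ 6" "q ^ 6 * q ^ 3 = q ^ 9"
    by (simp_all add: eval_nat_numeral)
  have Q2: "norm (q ^ 12) < 1"
    using q by (simp add: norm_power power_less_one_iff)
  have "- 1 / q * ((q ^ 6) ^ (m choose 2) * (- (q ^ 3)) ^ m * qpoch (- q) (q ^ 6) m * qpoch (- (q ^ 5)) (q ^ 6) m
      / qpoch (q ^ 6) (q ^ 6) m)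
      * ((q ^ 3 * (q ^ 6) ^ m - q * (q ^ 6) ^ m) * qpoch_inf (- (q ^ 3 * (q ^ 6) ^ m * q ^ 3)) (q ^ 3))
    = (1 - q ^ 2) * ((q ^ 6) ^ (m choose 2) * (- (q ^ 9)) ^ m * qpoch (- q) (q ^ 6) m * qpoch (- (q ^ 5)) (q ^ 6) m
      / qpoch (q ^ 6) (q ^ 6) m
      * (qpoch_inf (- (q ^ 9) * (q ^ 6) ^ m) (q ^ 6) * qpoch_inf (- (q ^ 6) * (q ^ 6) ^ m) (q ^ 6)))" for m
  proof -
    define P where "P = (q ^ 6) ^ (m choose 2) * qpoch (- q) (q ^ 6) m * qpoch (- (q ^ 5)) (q ^ 6) m
      / qpoch (q ^ 6) (q ^ 6) m
      * (qpoch_inf (- (q ^ 9) * (q ^ 6) ^ m) (q ^ 6) * qpoch_inf (- (q ^ 6) * (q ^ 6) ^ m) (q ^ 6))"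
    have "q ^ 3 * (q ^ 6) ^ m * q ^ 3 = q ^ 6 * (q ^ 6) ^ m"
      by (simp only: 1(4)[symmetric] mult_ac)
    then have eq: "qpoch_inf (- (q ^ 3 * (q ^ 6) ^ m * q ^ 3)) (q ^ 3)
        = qpoch_inf (- (q ^ 9) * (q ^ 6) ^ m) (q ^ 6) * qpoch_inf (- (q ^ 6) * (q ^ 6) ^ m) (q ^ 6)"
      by (simp only: qpoch_inf_dissect_cube[OF q(1)] 1) (rule mult.commute)
    have "- 1 / q * (- (q ^ 3)) ^ m * (q ^ 3 * (q ^ 6) ^ m - q * (q ^ 6) ^ m) = (1 - q ^ 2) * (- (q ^ 9)) ^ m"
    proof -
      have "- (q ^ 9) = - (q ^ 3) * q ^ 6" using 1(5) by (simp add: mult.commute)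
      then have "(- (q ^ 9)) ^ m = (- (q ^ 3)) ^ m * (q ^ 6) ^ m" by (simp only: power_mult_distrib)
      moreover have "- 1 / q * Y * (q ^ 3 * X - q * X) = (1 - q ^ 2) * (Y * X)" for X Y
        using q(2) by (simp add: field_simps power2_eq_square power3_eq_cube)
      ultimately show ?thesis by (simp only:)
    qed
    then have "- 1 / q * (- (q ^ 3)) ^ m * (q ^ 3 * (q ^ 6) ^ m - q * (q ^ 6) ^ m) * P
        = (1 - q ^ 2) * (- (q ^ 9)) ^ m * P" by (simp only:)
    moreover have "a * (b * c * d * e / f) * (g * (h * i)) = a * c * g * (b * d * e / f * (h * i))"
      "x * (b * y * d * e / f * (h * i)) = x * y * (b * d * e / f * (h * i))"
      for a b c d e f g h i x y :: complex by simp_all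
    ultimately show ?thesis
      unfolding eq P_def by (simp only:)
  qed
  \<comment> \<open>The Bailey product at \<open>a' * b = q ^ 14\<close> starts one factor late;
    \<open>1 - q ^ 2\<close> is the missing one.\<close>
  moreover have "qpoch_inf (q ^ 2) (q ^ 12) = (1 - q ^ 2) * qpoch_inf (q ^ 2 * q ^ 12) (q ^ 12)"
    by (rule qpoch_inf_step[OF Q2])
  ultimately show "(\<lambda>m. - 1 / q * ((q ^ 6) ^ (m choose 2) * (- (q ^ 3)) ^ m * qpoch (- q) (q ^ 6) m
      * qpoch (- (q ^ 5)) (q ^ 6) m / qpoch (q ^ 6) (q ^ 6) m)
      * ((q ^ 3 * (q ^ 6) ^ m - q * (q ^ 6) ^ m) * qpoch_inf (- (q ^ 3 * (q ^ 6) ^ m * q ^ 3)) (q ^ 3)))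
      sums (qpoch_inf (q ^ 2) (q ^ 12) * qpoch_inf (q ^ 10) (q ^ 12) / qpoch_inf (q ^ 6) (q ^ 12))"
    using sums_mult[OF outer_sum_bailey[OF Q 1(1), of "- (q ^ 9)"], of "1 - q ^ 2"]
    unfolding 1 qpoch_inf_minus_eq_inverse[OF Q] power_six_square
    by (simp only: times_divide_eq_right mult_ac)
qed (simp_all add: double_coeff_eq_0)

text \<open>The inner product splits into tails at \<open>- (q ^ 5)\<close>, which completes
  \<open>qpoch (- (q ^ 5)) (q ^ 6) m\<close>, and at \<open>- (q ^ 8)\<close>, which is
  \<open>a * x\<close> for \<open>a = - q\<close> and \<open>x = q ^ 7\<close>.\<close>

lemma second_identity:
  fixes q :: complex
  assumes q: "norm q < 1" "q \<noteq> 0"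
  shows "((\<lambda>(n, m). (-1) ^ (m + 1)
        * q powi (3 * binom2 (int n) + 2 * int n - 3 * int m * (int m + 1) - 1)
        * double_coeff q n m
        * (1 - q powi (3 * int n + 1) - q powi (3 * int n - 6 * int m)))
      has_sum
        (qpoch_inf q (q ^ 6) * qpoch_inf (q ^ 10) (q ^ 12) / qpoch_inf (q ^ 5) (q ^ 6)))
      (UNIV :: (nat \<times> nat) set)"
proof (rule has_sum_double_coeff[where s = "- 1 / q" and y = "- q" and z = "q ^ 2" and C = 3
      and w = "\<lambda>m k. 1 - (q ^ 3) ^ k - q * (q ^ 6) ^ m * (q ^ 3) ^ k"
      and B = "\<lambda>m. (q ^ 2 * (q ^ 6) ^ m - q * (q ^ 6) ^ m) * qpoch_inf (- (q ^ 2 * (q ^ 6) ^ m * q ^ 3)) (q ^ 3)",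
      OF q(1)])
  have Q: "norm (q ^ 6) < 1" by (rule power_six_less_one[OF q(1)])
  have p: "norm (q ^ 3) < 1" and q2: "norm (q ^ 2) < 1" and q5: "norm (q ^ 5) < 1"
    using q by (simp_all add: norm_power power_less_one_iff)
  show "norm (q ^ 2) \<le> 1" using q2 by simp
  fix m k :: nat
  show "norm (1 - (q ^ 3) ^ k - q * (q ^ 6) ^ m * (q ^ 3) ^ k) \<le> 3"
    by (rule norm_weight_le[OF q(1)])
  have "3 * binom2 (int (2 * m + k)) + 2 * int (2 * m + k) - 3 * int m * (int m + 1) - 1
      = int (6 * (m choose 2) + 6 * m * k + 3 * (k choose 2) + 1 * m + 2 * k) - 1"
    using exponent_shift[of m k] by simp
  note e = powi_exponent_shift[OF this q(2)]
  show "(case (2 * m + k, m) of (n, m) \<Rightarrow> (-1) ^ (m + 1)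
        * q powi (3 * binom2 (int n) + 2 * int n - 3 * int m * (int m + 1) - 1)
        * double_coeff q n m * (1 - q powi (3 * int n + 1) - q powi (3 * int n - 6 * int m)))
      = - 1 / q * (q ^ 6) ^ (m choose 2) * (- q) ^ m * (q ^ 3) ^ (k choose 2)
        * (q ^ 2 * (q ^ 6) ^ m) ^ k * double_coeff q (2 * m + k) m * (1 - (q ^ 3) ^ k - q * (q ^ 6) ^ m * (q ^ 3) ^ k)"
    unfolding prod.case weight_shift e power_minus[of q] by simp
  show "(\<lambda>k. (q ^ 3) ^ (k choose 2) / qpoch (q ^ 3) (q ^ 3) k * (q ^ 2 * (q ^ 6) ^ m) ^ k
        * (1 - (q ^ 3) ^ k - q * (q ^ 6) ^ m * (q ^ 3) ^ k))
      sums ((q ^ 2 * (q ^ 6) ^ m - q * (q ^ 6) ^ m) * qpoch_inf (- (q ^ 2 * (q ^ 6) ^ m * q ^ 3)) (q ^ 3))"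
    by (rule inner_sum_two_term[OF p])
  have 1: "q ^ 2 * q ^ 3 = q ^ 5" "- q * q ^ 7 = - (q ^ 5 * q ^ 3)" "q * q ^ 6 = q ^ 7" "(q ^ 5) ^ 2 = q ^ 10"
    by (simp_all add: eval_nat_numeral)
  have "- 1 / q * ((q ^ 6) ^ (m choose 2) * (- q) ^ m * qpoch (- q) (q ^ 6) m * qpoch (- (q ^ 5)) (q ^ 6) m
      / qpoch (q ^ 6) (q ^ 6) m)
      * ((q ^ 2 * (q ^ 6) ^ m - q * (q ^ 6) ^ m) * qpoch_inf (- (q ^ 2 * (q ^ 6) ^ m * q ^ 3)) (q ^ 3))
    = (1 - q) * ((-1) ^ m * (q ^ 6) ^ (m choose 2) * (q ^ 7) ^ m * qpoch (- q) (q ^ 6) m * qpoch (- (q ^ 5)) (q ^ 6) m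
      / qpoch (q ^ 6) (q ^ 6) m
      * (qpoch_inf (- (q ^ 5) * (q ^ 6) ^ m) (q ^ 6) * qpoch_inf (- q * q ^ 7 * (q ^ 6) ^ m) (q ^ 6)))" for m
  proof -
    define P where "P = (q ^ 6) ^ (m choose 2) * qpoch (- q) (q ^ 6) m * qpoch (- (q ^ 5)) (q ^ 6) m
      / qpoch (q ^ 6) (q ^ 6) m
      * (qpoch_inf (- (q ^ 5) * (q ^ 6) ^ m) (q ^ 6) * qpoch_inf (- q * q ^ 7 * (q ^ 6) ^ m) (q ^ 6))"
    have "q ^ 2 * (q ^ 6) ^ m * q ^ 3 = q ^ 5 * (q ^ 6) ^ m"
      by (simp only: 1(1)[symmetric] mult_ac)
    then have eq: "qpoch_inf (- (q ^ 2 * (q ^ 6) ^ m * q ^ 3)) (q ^ 3)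
        = qpoch_inf (- (q ^ 5) * (q ^ 6) ^ m) (q ^ 6) * qpoch_inf (- q * q ^ 7 * (q ^ 6) ^ m) (q ^ 6)"
      by (simp only: qpoch_inf_dissect_cube[OF q(1)] 1(2))
    have "- 1 / q * (- q) ^ m * (q ^ 2 * (q ^ 6) ^ m - q * (q ^ 6) ^ m) = (1 - q) * ((-1) ^ m * (q ^ 7) ^ m)"
    proof -
      have "(-1) ^ m * (q ^ 7) ^ m = (- q) ^ m * (q ^ 6) ^ m"
        unfolding 1(3)[symmetric] power_mult_distrib power_minus[of q] by (simp only: mult.assoc)
      moreover have "- 1 / q * Y * (q ^ 2 * X - q * X) = (1 - q) * (Y * X)" for X Y
        using q(2) by (simp add: field_simps power2_eq_square)
      ultimately show ?thesis by (simp only:)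
    qed
    then have "- 1 / q * (- q) ^ m * (q ^ 2 * (q ^ 6) ^ m - q * (q ^ 6) ^ m) * P
        = (1 - q) * ((-1) ^ m * (q ^ 7) ^ m) * P" by (simp only:)
    moreover have "a * (b * c * d * e / f) * (g * (h * i)) = a * c * g * (b * d * e / f * (h * i))"
      "x * (t * b * y * d * e / f * (h * i)) = x * (t * y) * (b * d * e / f * (h * i))"
      for a b c d e f g h i t x y :: complex by simp_all
    ultimately show ?thesis
      unfolding eq P_def by (simp only:)
  qed
  \<comment> \<open>The factor \<open>1 - q\<close> extends the product at \<open>q ^ 7\<close> down
    to \<open>q\<close>; the product at \<open>- (q ^ 5)\<close> is rewritten by difference of
    squares.\<close>
  moreover have "(1 - q) * (qpoch_inf (- (q ^ 5)) (q ^ 6) * qpoch_inf (q ^ 7) (q ^ 6))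
      = qpoch_inf q (q ^ 6) * qpoch_inf (q ^ 10) (q ^ 12) / qpoch_inf (q ^ 5) (q ^ 6)"
    using qpoch_inf_step[OF Q, of q] qpoch_inf_square[OF Q, of "q ^ 5"] qpoch_inf_nonzero[OF q5 Q]
    unfolding 1 power_six_square by simp
  ultimately show "(\<lambda>m. - 1 / q * ((q ^ 6) ^ (m choose 2) * (- q) ^ m * qpoch (- q) (q ^ 6) m
      * qpoch (- (q ^ 5)) (q ^ 6) m / qpoch (q ^ 6) (q ^ 6) m)
      * ((q ^ 2 * (q ^ 6) ^ m - q * (q ^ 6) ^ m) * qpoch_inf (- (q ^ 2 * (q ^ 6) ^ m * q ^ 3)) (q ^ 3)))
      sums (qpoch_inf q (q ^ 6) * qpoch_inf (q ^ 10) (q ^ 12) / qpoch_inf (q ^ 5) (q ^ 6))"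
    using sums_mult[OF outer_sum_one_phi_one[OF Q, of "q ^ 7" "- q" "- (q ^ 5)"], of "1 - q"]
    by (simp only:)
qed (simp_all add: double_coeff_eq_0)

text \<open>Here \<open>outer_sum_one_phi_one\<close> is used with the roles exchanged: the symbol
  at \<open>- q\<close> is completed, and \<open>a = - (q ^ 5)\<close>,
  \<open>x = q ^ 5\<close>.\<close>

lemma fourth_identity:
  fixes q :: complex
  assumes q: "norm q < 1" "q \<noteq> 0"
  shows "((\<lambda>(n, m). (-1) ^ (m + 1)
        * q powi (3 * binom2 (int n + 1) - 2 * int n - 3 * int m * (int m + 1) - 1)
        * double_coeff q n m
        * (1 + q powi (3 * int n - 12 * int m - 3) * (1 + q powi (1 + 6 * int m))
               * (q powi (3 * int n) - q powi (6 * int m) * (1 + q ^ 3))))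
      has_sum
        (qpoch_inf (q ^ 2) (q ^ 12) * qpoch_inf (q ^ 5) (q ^ 12) * qpoch_inf (q ^ 11) (q ^ 12)
          / qpoch_inf q (q ^ 6)))
      (UNIV :: (nat \<times> nat) set)"
proof (rule has_sum_double_coeff[where s = "- 1 / q" and y = "- (1 / q)" and z = q and C = "1 + 2 / norm (q ^ 3) * 3"
      and w = "\<lambda>m k. 1 + (1 + q * (q ^ 6) ^ m) / q ^ 3 * (((q ^ 3) ^ k) ^ 2 - (1 + q ^ 3) * (q ^ 3) ^ k)"
      and B = "\<lambda>m. - (q * (q ^ 6) ^ m) * (1 + q * (q ^ 6) ^ m) * qpoch_inf (- (q * (q ^ 6) ^ m * (q ^ 3) ^ 2)) (q ^ 3)",
      OF q(1)])
  have Q: "norm (q ^ 6) < 1" by (rule power_six_less_one[OF q(1)])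
  have p: "norm (q ^ 3) < 1" "q ^ 3 \<noteq> 0"
    using q by (simp_all add: norm_power power_less_one_iff)
  show "norm q \<le> 1" using q by simp
  fix m k :: nat
  show "norm (1 + (1 + q * (q ^ 6) ^ m) / q ^ 3 * (((q ^ 3) ^ k) ^ 2 - (1 + q ^ 3) * (q ^ 3) ^ k))
      \<le> 1 + 2 / norm (q ^ 3) * 3"
    by (rule norm_weight_le'[OF q(1)])
  \<comment> \<open>The linear part in \<open>m\<close> is negative, so \<open>- int m\<close> is
    kept apart and becomes the base \<open>1 / q\<close> in \<open>y\<close>.\<close>
  have "3 * binom2 (int (2 * m + k) + 1) - 2 * int (2 * m + k) - 3 * int m * (int m + 1) - 1
      = (int (6 * (m choose 2) + 6 * m * k + 3 * (k choose 2) + 0 * m + 1 * k) - 1) - int m"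
    using exponent_shift[of m k] unfolding binom2_of_nat_plus_one binom2_of_nat by simp
  then have e: "q powi (3 * binom2 (int (2 * m + k) + 1) - 2 * int (2 * m + k) - 3 * int m * (int m + 1) - 1)
      = (q ^ 6) ^ (m choose 2) * (q ^ 0) ^ m * (q ^ 3) ^ (k choose 2) * (q ^ 1 * (q ^ 6) ^ m) ^ k / q / q ^ m"
    by (simp only: power_int_diff[OF disjI1[OF q(2)], of _ "int m"] powi_exponent_shift[OF refl q(2)] power_int_of_nat)
  show "(case (2 * m + k, m) of (n, m) \<Rightarrow> (-1) ^ (m + 1)
        * q powi (3 * binom2 (int n + 1) - 2 * int n - 3 * int m * (int m + 1) - 1)
        * double_coeff q n m * (1 + q powi (3 * int n - 12 * int m - 3) * (1 + q powi (1 + 6 * int m))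
               * (q powi (3 * int n) - q powi (6 * int m) * (1 + q ^ 3))))
      = - 1 / q * (q ^ 6) ^ (m choose 2) * (- (1 / q)) ^ m * (q ^ 3) ^ (k choose 2)
        * (q * (q ^ 6) ^ m) ^ k * double_coeff q (2 * m + k) m
        * (1 + (1 + q * (q ^ 6) ^ m) / q ^ 3 * (((q ^ 3) ^ k) ^ 2 - (1 + q ^ 3) * (q ^ 3) ^ k))"
    unfolding prod.case weight_shift'[OF q(2)] e power_minus[of "1 / q"] by (simp add: power_one_over)
  show "(\<lambda>k. (q ^ 3) ^ (k choose 2) / qpoch (q ^ 3) (q ^ 3) k * (q * (q ^ 6) ^ m) ^ k
        * (1 + (1 + q * (q ^ 6) ^ m) / q ^ 3 * (((q ^ 3) ^ k) ^ 2 - (1 + q ^ 3) * (q ^ 3) ^ k)))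
      sums (- (q * (q ^ 6) ^ m) * (1 + q * (q ^ 6) ^ m) * qpoch_inf (- (q * (q ^ 6) ^ m * (q ^ 3) ^ 2)) (q ^ 3))"
    by (rule inner_sum_three_term[OF p])
  have 1: "q * (q ^ 3) ^ 2 = q ^ 7" "- (q ^ 5) * q ^ 5 = - (q ^ 7 * q ^ 3)" "q * q ^ 6 = q ^ 7"
    "q ^ 5 * q ^ 6 = q ^ 11"
    by (simp_all add: eval_nat_numeral)
  have "- 1 / q * ((q ^ 6) ^ (m choose 2) * (- (1 / q)) ^ m * qpoch (- q) (q ^ 6) m * qpoch (- (q ^ 5)) (q ^ 6) m
      / qpoch (q ^ 6) (q ^ 6) m)
      * (- (q * (q ^ 6) ^ m) * (1 + q * (q ^ 6) ^ m) * qpoch_inf (- (q * (q ^ 6) ^ m * (q ^ 3) ^ 2)) (q ^ 3))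
    = (-1) ^ m * (q ^ 6) ^ (m choose 2) * (q ^ 5) ^ m * qpoch (- (q ^ 5)) (q ^ 6) m * qpoch (- q) (q ^ 6) m
      / qpoch (q ^ 6) (q ^ 6) m
      * (qpoch_inf (- q * (q ^ 6) ^ m) (q ^ 6) * qpoch_inf (- (q ^ 5) * q ^ 5 * (q ^ 6) ^ m) (q ^ 6))" for m
  proof -
    define P where "P = (q ^ 6) ^ (m choose 2) * qpoch (- (q ^ 5)) (q ^ 6) m * qpoch (- q) (q ^ 6) m
      / qpoch (q ^ 6) (q ^ 6) m
      * (qpoch_inf (- q * (q ^ 6) ^ m) (q ^ 6) * qpoch_inf (- (q ^ 5) * q ^ 5 * (q ^ 6) ^ m) (q ^ 6))"
    have "q * (q ^ 6) ^ m * (q ^ 3) ^ 2 = q ^ 7 * (q ^ 6) ^ m"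
      by (simp only: 1(1)[symmetric] mult_ac)
    then have "qpoch_inf (- (q * (q ^ 6) ^ m * (q ^ 3) ^ 2)) (q ^ 3)
        = qpoch_inf (- (q ^ 7) * (q ^ 6) ^ m) (q ^ 6) * qpoch_inf (- (q ^ 5) * q ^ 5 * (q ^ 6) ^ m) (q ^ 6)"
      by (simp only: qpoch_inf_dissect_cube[OF q(1)] 1(2))
    \<comment> \<open>The factor \<open>1 + z\<close> from the inner sum extends the tail at
      \<open>- (q ^ 7)\<close> to one at \<open>- q\<close>, which can then absorb
      \<open>qpoch (- q) (q ^ 6) m\<close>.\<close>
    moreover have "qpoch_inf (- q * (q ^ 6) ^ m) (q ^ 6)
        = (1 + q * (q ^ 6) ^ m) * qpoch_inf (- (q ^ 7) * (q ^ 6) ^ m) (q ^ 6)"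
      using qpoch_inf_step[OF Q, of "- q * (q ^ 6) ^ m"] unfolding 1(3)[symmetric] by (simp add: mult_ac)
    ultimately have eq: "(1 + q * (q ^ 6) ^ m) * qpoch_inf (- (q * (q ^ 6) ^ m * (q ^ 3) ^ 2)) (q ^ 3)
        = qpoch_inf (- q * (q ^ 6) ^ m) (q ^ 6) * qpoch_inf (- (q ^ 5) * q ^ 5 * (q ^ 6) ^ m) (q ^ 6)"
      by (simp only: mult.assoc)
    have "- 1 / q * (- (1 / q)) ^ m * - (q * (q ^ 6) ^ m) = (-1) ^ m * (q ^ 5) ^ m"
    proof -
      have "- 1 * q ^ 5 = - (1 / q) * q ^ 6" using q(2) by (simp add: eval_nat_numeral)
      then have "(-1) ^ m * (q ^ 5) ^ m = (- (1 / q)) ^ m * (q ^ 6) ^ m"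
        by (simp only: power_mult_distrib[symmetric])
      moreover have "- 1 / q * Y * - (q * X) = Y * X" for X Y
        using q(2) by simp
      ultimately show ?thesis by (simp only:)
    qed
    then have "- 1 / q * (- (1 / q)) ^ m * - (q * (q ^ 6) ^ m) * P
        = (-1) ^ m * (q ^ 5) ^ m * P" by (simp only:)
    moreover have "a * (b * c * d * e / f) * (g * x * j) = a * c * g * (b * e * d / f * (x * j))"
      "t * b * y * e * d / f * (h * i) = (t * y) * (b * e * d / f * (h * i))"
      for a b c d e f g h i j t x y :: complex by simp_all
    ultimately show ?thesis
      unfolding P_def by (simp only: eq)
  qed
  moreover have "qpoch_inf (- q) (q ^ 6) * qpoch_inf (q ^ 5) (q ^ 6)
      = qpoch_inf (q ^ 2) (q ^ 12) * qpoch_inf (q ^ 5) (q ^ 12) * qpoch_inf (q ^ 11) (q ^ 12) / qpoch_inf q (q ^ 6)"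
    using qpoch_inf_dissect[OF Q, of "q ^ 5"] qpoch_inf_square[OF Q, of q] qpoch_inf_nonzero[OF q(1) Q]
    unfolding 1 power_six_square by simp
  ultimately show "(\<lambda>m. - 1 / q * ((q ^ 6) ^ (m choose 2) * (- (1 / q)) ^ m * qpoch (- q) (q ^ 6) m
      * qpoch (- (q ^ 5)) (q ^ 6) m / qpoch (q ^ 6) (q ^ 6) m)
      * (- (q * (q ^ 6) ^ m) * (1 + q * (q ^ 6) ^ m) * qpoch_inf (- (q * (q ^ 6) ^ m * (q ^ 3) ^ 2)) (q ^ 3)))
      sums (qpoch_inf (q ^ 2) (q ^ 12) * qpoch_inf (q ^ 5) (q ^ 12) * qpoch_inf (q ^ 11) (q ^ 12)
          / qpoch_inf q (q ^ 6))"
    using outer_sum_one_phi_one[OF Q, of "q ^ 5" "- (q ^ 5)" "- q"]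
    by (simp only:)
qed (simp_all add: double_coeff_eq_0)

text \<open>The condition \<open>q \<noteq> 0\<close> guards the last three sums, which contain
  negative powers of \<open>q\<close>, already at \<open>n = m = 0\<close>. All sums are
  unconditional over pairs.\<close>

theorem theorem1p2:
  fixes q :: complex
  assumes "norm q < 1"
  shows
    "((\<lambda>(n, m). (-1) ^ m
        * q powi (3 * binom2 (int n + 1) - 3 * int m * (int m + 1))
        * double_coeff q n m)
      has_sum
        (qpoch_inf (q ^ 4) (q ^ 12) * qpoch_inf (q ^ 8) (q ^ 12) / qpoch_inf (q ^ 6) (q ^ 12)))
      (UNIV :: (nat \<times> nat) set)
     \<and> (q \<noteq> 0 \<longrightarrow>
     ((\<lambda>(n, m). (-1) ^ (m + 1)
        * q powi (3 * binom2 (int n) + 2 * int n - 3 * int m * (int m + 1) - 1)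
        * double_coeff q n m
        * (1 - q powi (3 * int n + 1) - q powi (3 * int n - 6 * int m)))
      has_sum
        (qpoch_inf q (q ^ 6) * qpoch_inf (q ^ 10) (q ^ 12) / qpoch_inf (q ^ 5) (q ^ 6)))
      (UNIV :: (nat \<times> nat) set)
     \<and>
     ((\<lambda>(n, m). (-1) ^ (m + 1)
        * q powi (3 * binom2 (int n + 1) - 3 * int m * (int m + 1) - 1)
        * double_coeff q n m
        * (1 - q powi (3 * int n + 1) - q powi (3 * int n - 6 * int m)))
      has_sum
        (qpoch_inf (q ^ 2) (q ^ 12) * qpoch_inf (q ^ 10) (q ^ 12) / qpoch_inf (q ^ 6) (q ^ 12)))
      (UNIV :: (nat \<times> nat) set)
     \<and>
     ((\<lambda>(n, m). (-1) ^ (m + 1)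
        * q powi (3 * binom2 (int n + 1) - 2 * int n - 3 * int m * (int m + 1) - 1)
        * double_coeff q n m
        * (1 + q powi (3 * int n - 12 * int m - 3) * (1 + q powi (1 + 6 * int m))
               * (q powi (3 * int n) - q powi (6 * int m) * (1 + q ^ 3))))
      has_sum
        (qpoch_inf (q ^ 2) (q ^ 12) * qpoch_inf (q ^ 5) (q ^ 12) * qpoch_inf (q ^ 11) (q ^ 12)
          / qpoch_inf q (q ^ 6)))
      (UNIV :: (nat \<times> nat) set))"
  using first_identity[OF assms] second_identity[OF assms] third_identity[OF assms]
    fourth_identity[OF assms] by blast

end
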